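(* Let $c>0$, let $\lambda$ be a $C^1$ real function on $(0,\infty)$ with $\lambda\neq 0$ everywhere, let $\Omega=\{(s,t)\in\mathbb{R}^2 : s>0,\ t>0,\ s+t>c\}$ with closure $\overline{\Omega}$, and let $\{g,h,f,n\}$ be weakly compatible Cauchy--Goursat data. Set $$\mathcal{F}(s,t)=\frac{\mathcal{G}(s,t)}{2\lambda(s+t)},\qquad K_1(s,t,\sigma)=\frac{\lambda'(\sigma+t)}{2\lambda(s+t)},\qquad K_2(s,t,\tau)=\frac{\lambda'(s+\tau)}{2\lambda(s+t)},$$ where $\mathcal{G}$ is the boundary forcing built from the data (defined in the context). Then the Volterra integral equation $$x(s,t)=\mathcal{F}(s,t)+\int_{(c-t)^+}^{s}K_1(s,t,\sigma)\,x(\sigma,t)\,d\sigma+\int_{(c-s)^+}^{t}K_2(s,t,\tau)\,x(s,\tau)\,d\tau,\qquad (s,t)\in\overline{\Omega},$$ possesses a unique continuous solution $x\in C(\overline{\Omega})$. Moreover, this solution attains the Cauchy--Goursat boundary conditions $\{g,h,f,n\}$.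
   Context: Notation: $\xi^+=\max(\xi,0)$. The boundary of $\Omega$ consists of $\Gamma_1=\{(s,0): s\ge c\}$, $\Gamma_2=\{(0,t): t\ge c\}$ and $\Gamma_C=\{(s,c-s): 0\le s\le c\}$. The data are functions $g:[c,\infty)\to\mathbb{R}$ (prescribed values of $x$ on $\Gamma_1$), $h:[c,\infty)\to\mathbb{R}$ (values on $\Gamma_2$), $f:[0,c]\to\mathbb{R}$ (values $x(s,c-s)=f(s)$ on $\Gamma_C$), and $n$ on $[0,c]$ (prescribed value of $(\partial_s+\partial_t)x$ at $(s,c-s)$). Weakly compatible data: (1) $\{g,h,f\}$ are $C^0$-compatible, i.e. some continuous function on a neighborhood of $\partial\Omega$ restricts to $g,h,f$ on $\Gamma_1,\Gamma_2,\Gamma_C$ (in particular $g,h,f$ are continuous, $g(c)=f(c)$, $h(c)=f(0)$); (2) $f$ is absolutely continuous (so $f'\in L^1$); (3) $n\in L^1([0,c])$. Attainment: $x\in C(\overline{\Omega})$ attains $\{g,h,f,n\}$ if $x(s,0)=g(s)$ for $s\ge c$, $x(0,t)=h(t)$ for $t\ge c$, $x(s,c-s)=f(s)$ for $0\le s\le c$, and for almost every $s\in[0,c]$ the limit $\lim_{z\to0^+}\frac{x(s+z,c-s+z)-x(s,c-s)}{z}$ exists and equals $n(s)$. Boundary forcing: $\mathcal{G}(s,t)=G_1(s)+G_2(t)+\int_{(c-t)^+}^{\min(c,s)}\lambda(c)\,n(\sigma)\,d\sigma$, where $G_1(s)=\lambda(c)f(s)$ if $s\le c$, and $G_1(s)=2\lambda(s)g(s)-\lambda(c)g(c)-\int_c^s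 g(\sigma)\lambda'(\sigma)\,d\sigma$ if $s>c$; $G_2(t)=\lambda(c)f(c-t)$ if $t\le c$, and $G_2(t)=2\lambda(t)h(t)-\lambda(c)h(c)-\int_c^t h(\tau)\lambda'(\tau)\,d\tau$ if $t>c$. *)

theory Defs
  imports "HOL-Analysis.Analysis"
begin

definition Omega :: "real \<Rightarrow> (real \<times> real) set" where
  "Omega c = {(s, t). s > 0 \<and> t > 0 \<and> s + t > c}"

text \<open>
  Absolute continuity of a function on an interval, by the usual epsilon-delta condition over
  finite families of non-overlapping closed subintervals (the library constant
  \<open>absolutely_continuous\<close> is the corresponding notion for measures). Degenerate
  members \<open>a i = b i\<close> are allowed; they contribute nothing to either sum.
\<close>

definition abs_cont_on :: "real set \<Rightarrow> (real \<Rightarrow> real) \<Rightarrow> bool" where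
  "abs_cont_on I f \<longleftrightarrow>
     (\<forall>\<epsilon>>0. \<exists>\<delta>>0. \<forall>(N::nat) a b.
        (\<forall>i<N. a i \<le> b i \<and> {a i..b i} \<subseteq> I) \<longrightarrow>
        (\<forall>i<N. \<forall>j<N. i \<noteq> j \<longrightarrow> {a i<..<b i} \<inter> {a j<..<b j} = {}) \<longrightarrow>
        (\<Sum>i<N. b i - a i) < \<delta> \<longrightarrow>
        (\<Sum>i<N. \<bar>f (b i) - f (a i)\<bar>) < \<epsilon>)"

text \<open>
  The data \<open>g, h\<close> live on \<open>[c, \<infinity>)\<close> and \<open>f, n\<close> on
  \<open>[0, c]\<close>; here they are total functions, and only their values on those intervals are used.
\<close>

definition C0_compatible ::
    "real \<Rightarrow> (real \<Rightarrow> real) \<Rightarrow> (real \<Rightarrow> real) \<Rightarrow> (real \<Rightarrow> real) \<Rightarrow> bool" where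
  "C0_compatible c g h f \<longleftrightarrow>
     (\<exists>U \<phi>. open U \<and> frontier (Omega c) \<subseteq> U \<and> continuous_on U \<phi> \<and>
        (\<forall>s\<ge>c. \<phi> (s, 0) = g s) \<and>
        (\<forall>t\<ge>c. \<phi> (0, t) = h t) \<and>
        (\<forall>s\<in>{0..c}. \<phi> (s, c - s) = f s))"

definition weakly_compatible ::
    "real \<Rightarrow> (real \<Rightarrow> real) \<Rightarrow> (real \<Rightarrow> real) \<Rightarrow> (real \<Rightarrow> real) \<Rightarrow> (real \<Rightarrow> real) \<Rightarrow> bool" where
  "weakly_compatible c g h f n \<longleftrightarrow>
     C0_compatible c g h f \<and> abs_cont_on {0..c} f \<and> n absolutely_integrable_on {0..c}"

definition attains ::
    "real \<Rightarrow> (real \<Rightarrow> real) \<Rightarrow> (real \<Rightarrow> real) \<Rightarrow> (real \<Rightarrow> real) \<Rightarrow> (real \<Rightarrow> real) \<Rightarrow>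
      (real \<times> real \<Rightarrow> real) \<Rightarrow> bool" where
  "attains c g h f n x \<longleftrightarrow>
     (\<forall>s\<ge>c. x (s, 0) = g s) \<and>
     (\<forall>t\<ge>c. x (0, t) = h t) \<and>
     (\<forall>s\<in>{0..c}. x (s, c - s) = f s) \<and>
     (AE s in lebesgue_on {0..c}.
        ((\<lambda>z. (x (s + z, c - s + z) - x (s, c - s)) / z) \<longlongrightarrow> n s) (at_right 0))"

text \<open>
  All integrals below are over \<open>[a, b]\<close> with \<open>a \<le> b\<close> whenever
  \<open>(s, t)\<close> lies in the closure of \<open>Omega c\<close>, and the integrands of interest are
  continuous or absolutely integrable, so the gauge integral is the Lebesgue integral.
\<close>

definition G1 :: "real \<Rightarrow> (real \<Rightarrow> real) \<Rightarrow> (real \<Rightarrow> real) \<Rightarrow> (real \<Rightarrow> real) \<Rightarrow> real \<Rightarrow> real" where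
  "G1 c lam g f s =
     (if s \<le> c then lam c * f s
      else 2 * lam s * g s - lam c * g c - integral {c..s} (\<lambda>\<sigma>. g \<sigma> * deriv lam \<sigma>))"

definition G2 :: "real \<Rightarrow> (real \<Rightarrow> real) \<Rightarrow> (real \<Rightarrow> real) \<Rightarrow> (real \<Rightarrow> real) \<Rightarrow> real \<Rightarrow> real" where
  "G2 c lam h f t =
     (if t \<le> c then lam c * f (c - t)
      else 2 * lam t * h t - lam c * h c - integral {c..t} (\<lambda>\<tau>. h \<tau> * deriv lam \<tau>))"

definition boundary_forcing ::
    "real \<Rightarrow> (real \<Rightarrow> real) \<Rightarrow> (real \<Rightarrow> real) \<Rightarrow> (real \<Rightarrow> real) \<Rightarrow> (real \<Rightarrow> real) \<Rightarrow> (real \<Rightarrow> real) \<Rightarrow>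
      real \<Rightarrow> real \<Rightarrow> real" where
  "boundary_forcing c lam g h f n s t =
     G1 c lam g f s + G2 c lam h f t +
     integral {max (c - t) 0..min c s} (\<lambda>\<sigma>. lam c * n \<sigma>)"

definition forcing ::
    "real \<Rightarrow> (real \<Rightarrow> real) \<Rightarrow> (real \<Rightarrow> real) \<Rightarrow> (real \<Rightarrow> real) \<Rightarrow> (real \<Rightarrow> real) \<Rightarrow> (real \<Rightarrow> real) \<Rightarrow>
      real \<Rightarrow> real \<Rightarrow> real" where
  "forcing c lam g h f n s t = boundary_forcing c lam g h f n s t / (2 * lam (s + t))"

definition K1 :: "(real \<Rightarrow> real) \<Rightarrow> real \<Rightarrow> real \<Rightarrow> real \<Rightarrow> real" where
  "K1 lam s t \<sigma> = deriv lam (\<sigma> + t) / (2 * lam (s + t))"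

definition K2 :: "(real \<Rightarrow> real) \<Rightarrow> real \<Rightarrow> real \<Rightarrow> real \<Rightarrow> real" where
  "K2 lam s t \<tau> = deriv lam (s + \<tau>) / (2 * lam (s + t))"

definition solves_volterra ::
    "real \<Rightarrow> (real \<Rightarrow> real) \<Rightarrow> (real \<Rightarrow> real) \<Rightarrow> (real \<Rightarrow> real) \<Rightarrow> (real \<Rightarrow> real) \<Rightarrow> (real \<Rightarrow> real) \<Rightarrow>
      (real \<times> real \<Rightarrow> real) \<Rightarrow> bool" where
  "solves_volterra c lam g h f n x \<longleftrightarrow>
     (\<forall>(s, t) \<in> closure (Omega c).
        x (s, t) = forcing c lam g h f n s t
          + integral {max (c - t) 0..s} (\<lambda>\<sigma>. K1 lam s t \<sigma> * x (\<sigma>, t))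
          + integral {max (c - s) 0..t} (\<lambda>\<tau>. K2 lam s t \<tau> * x (s, \<tau>)))"

end

theory Submission
  imports Defs
begin

text \<open>
  The closure of \<open>Omega c\<close> is the set \<open>wedge c\<close> of points with nonnegative coordinates whose
  sum is at least \<open>c\<close>. Both integrals at \<open>(s, t)\<close> run over segments that lead to the
  point from the left and from below and never leave the wedge. On a bounded piece of it the right-hand
  side of the equation is therefore a contraction for the sup norm weighted by \<open>exp (- M * (s + t))\<close>
  once \<open>M\<close> is large: integrating the weight along a segment costs a factor \<open>1 / M\<close>.
  Banach's theorem gives a unique solution on each piece (\<open>volterra_local\<close>), and these fit together
  by uniqueness (\<open>volterra_global\<close>). The forcing is continuous because \<open>G1\<close> and \<open>G2\<close>
  match at \<open>c\<close> by \<open>g c = f c\<close> and \<open>h c = f 0\<close>.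

  The boundary values are read off from the equation multiplied by \<open>2 * lam (s + t)\<close>. On the
  diagonal both integrals vanish. On the horizontal edge the forcing is built so that
  \<open>w s = x (s, 0) - g s\<close> satisfies \<open>2 * lam s * w s = I s\<close>, where \<open>I s\<close> is the
  integral of \<open>lam' * w\<close> over \<open>{c..s}\<close>. Hence \<open>I\<^sup>2 / lam\<close> has derivative zero, so it
  vanishes together with \<open>w\<close> (\<open>zero_of_homogeneous_edge_equation\<close>). The vertical edge is
  symmetric.

  For the normal derivative, the equation at \<open>(s + z, c - s + z)\<close> is divided by \<open>z\<close>. The
  terms containing \<open>lam'\<close> are averages of continuous functions over shrinking intervals; together
  they cancel the variation of the factor \<open>lam (c + 2 * z)\<close>. The integral of \<open>n\<close> over
  \<open>{s - z..s + z}\<close> contributes \<open>2 * n s\<close> at almost every \<open>s\<close> by Lebesgue's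
  differentiation theorem. What remains is \<open>(f (s + z) + f (s - z) - 2 * f s) / z\<close>, which must
  tend to zero at almost every \<open>s\<close> (\<open>abs_cont_on_second_difference\<close>). This is where the
  absolute continuity of \<open>f\<close> enters: \<open>f\<close> is an indefinite integral
  (\<open>abs_cont_on_has_integral\<close>), so Lebesgue's theorem applies from both sides. To see this,
  \<open>f\<close> is written as the difference of two monotone absolutely continuous functions, its total
  variation \<open>V\<close> and \<open>V - f\<close>; the Stieltjes measure of such a function vanishes on Lebesgue
  null sets, and its Radon--Nikodym density is the integrand.
\<close>

section \<open>Families of nonoverlapping intervals and total variation\<close>

text \<open>
  The index type is arbitrary: families indexed by pairs arise when each member of a family is subdivided,
  and families indexed by sets of reals arise from coverings.
\<close>

definition interval_family :: "real set \<Rightarrow> 'i set \<Rightarrow> ('i \<Rightarrow> real) \<Rightarrow> ('i \<Rightarrow> real) \<Rightarrow> bool" where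
  "interval_family S I u v \<longleftrightarrow>
     finite I \<and> (\<forall>i\<in>I. u i \<le> v i \<and> {u i..v i} \<subseteq> S) \<and>
     (\<forall>i\<in>I. \<forall>j\<in>I. i \<noteq> j \<longrightarrow> {u i<..<v i} \<inter> {u j<..<v j} = {})"

definition variation_sum :: "(real \<Rightarrow> real) \<Rightarrow> 'i set \<Rightarrow> ('i \<Rightarrow> real) \<Rightarrow> ('i \<Rightarrow> real) \<Rightarrow> real" where
  "variation_sum f I u v = (\<Sum>i\<in>I. \<bar>f (v i) - f (u i)\<bar>)"

lemma interval_familyD:
  assumes "interval_family S I u v"
  shows "finite I" "\<And>i. i \<in> I \<Longrightarrow> u i \<le> v i" "\<And>i. i \<in> I \<Longrightarrow> {u i..v i} \<subseteq> S"
    "\<And>i. i \<in> I \<Longrightarrow> u i \<in> S" "\<And>i. i \<in> I \<Longrightarrow> v i \<in> S"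
    "\<And>i j. i \<in> I \<Longrightarrow> j \<in> I \<Longrightarrow> i \<noteq> j \<Longrightarrow> {u i<..<v i} \<inter> {u j<..<v j} = {}"
  using assms unfolding interval_family_def by fastforce+

text \<open>
  The open intervals are pairwise disjoint, so their lengths add up to the measure of their union.
\<close>

lemma interval_family_length:
  assumes fam: "interval_family S I u v" and T: "S \<subseteq> T" "T \<in> lmeasurable"
  shows "(\<Sum>i\<in>I. v i - u i) \<le> measure lebesgue T"
proof -
  have disj: "disjoint_family_on (\<lambda>i. {u i<..<v i}) I"
    using interval_familyD(6)[OF fam] by (auto simp: disjoint_family_on_def)
  have "ennreal (\<Sum>i\<in>I. v i - u i) = (\<Sum>i\<in>I. emeasure lebesgue {u i<..<v i})"
    using interval_familyD(2)[OF fam] by (subst sum_ennreal[symmetric]) auto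
  also have "\<dots> = emeasure lebesgue (\<Union>i\<in>I. {u i<..<v i})"
    using disj interval_familyD(1)[OF fam] by (intro sum_emeasure) auto
  also have "\<dots> \<le> emeasure lebesgue T"
    using interval_familyD(3)[OF fam] T
    by (intro emeasure_mono) (auto simp: fmeasurable_def less_imp_le subset_iff)
  also have "\<dots> = ennreal (measure lebesgue T)"
    using T by (simp add: emeasure_eq_measure2)
  finally show ?thesis
    by (simp add: ennreal_le_iff)
qed

lemma interval_family_mono:
  "interval_family S I u v \<Longrightarrow> S \<subseteq> T \<Longrightarrow> interval_family T I u v"
  unfolding interval_family_def by fast

text \<open>
  Clipping a family to a smaller interval keeps it nonoverlapping because every open member only shrinks.
\<close>

lemma interval_family_shrink:
  assumes fam: "interval_family S I u v"
    and "\<And>i. i \<in> I \<Longrightarrow> u' i \<le> v' i" "\<And>i. i \<in> I \<Longrightarrow> {u' i..v' i} \<subseteq> T"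
    and sub: "\<And>i. {u' i<..<v' i} \<subseteq> {u i<..<v i}"
  shows "interval_family T I u' v'"
proof -
  have "{u' i<..<v' i} \<inter> {u' j<..<v' j} = {}" if "i \<in> I" "j \<in> I" "i \<noteq> j" for i j
    using interval_familyD(6)[OF fam that] sub[of i] sub[of j] by blast
  then show ?thesis
    using assms(2,3) interval_familyD(1)[OF fam] by (simp add: interval_family_def)
qed

lemma interval_family_clip:
  assumes "interval_family S I u v" and "l \<le> r"
  shows "interval_family {l..r} I (\<lambda>i. max l (min r (u i))) (\<lambda>i. max l (min r (v i)))"
  using interval_familyD(2)[OF assms(1)] assms(2)
  by (intro interval_family_shrink[OF assms(1)]) (auto intro: max.coboundedI2 min.mono)

lemma interval_family_clip_le:
  assumes "interval_family {a..y} I u v" and "a \<le> x"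
  shows "interval_family {a..x} I (\<lambda>i. min x (u i)) (\<lambda>i. min x (v i))"
  using interval_familyD(2,4)[OF assms(1)] assms(2)
  by (intro interval_family_shrink[OF assms(1)]) (auto intro: min.coboundedI2)

lemma interval_family_clip_ge:
  assumes "interval_family {a..y} I u v" and "x \<le> y"
  shows "interval_family {x..y} I (\<lambda>i. max x (u i)) (\<lambda>i. max x (v i))"
  using interval_familyD(2,5)[OF assms(1)] assms(2)
  by (intro interval_family_shrink[OF assms(1)]) (auto intro: max.coboundedI2)

text \<open>
  Splitting a family at \<open>x\<close> by \<open>min\<close> and \<open>max\<close> treats all positions of \<open>x\<close> uniformly, since
  \<open>f (min x y) + f (max x y) = f x + f y\<close>; no interval has to be cut explicitly.
\<close>

lemma variation_sum_clip:
  "variation_sum f I u v \<le>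
     variation_sum f I (\<lambda>i. min x (u i)) (\<lambda>i. min x (v i)) +
     variation_sum f I (\<lambda>i. max x (u i)) (\<lambda>i. max x (v i))"
proof -
  have "f (min x y) + f (max x y) = f x + f y" for y
    by (simp add: min_def max_def)
  then have "\<bar>f (v i) - f (u i)\<bar> \<le>
      \<bar>f (min x (v i)) - f (min x (u i))\<bar> + \<bar>f (max x (v i)) - f (max x (u i))\<bar>" for i
    by (smt (verit))
  then show ?thesis
    unfolding variation_sum_def by (simp add: sum.distrib[symmetric] sum_mono)
qed

lemma abs_cont_on_family:
  assumes ac: "abs_cont_on S f" and "\<epsilon> > 0"
  obtains \<delta> where "\<delta> > 0"
    "\<And>(I::'i set) u v. interval_family S I u v \<Longrightarrow> (\<Sum>i\<in>I. v i - u i) < \<delta> \<Longrightarrow>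
       variation_sum f I u v < \<epsilon>"
proof -
  obtain \<delta> where "\<delta> > 0" and \<delta>: "\<And>(N::nat) a b.
        (\<forall>i<N. a i \<le> b i \<and> {a i..b i} \<subseteq> S) \<Longrightarrow>
        (\<forall>i<N. \<forall>j<N. i \<noteq> j \<longrightarrow> {a i<..<b i} \<inter> {a j<..<b j} = {}) \<Longrightarrow>
        (\<Sum>i<N. b i - a i) < \<delta> \<Longrightarrow> (\<Sum>i<N. \<bar>f (b i) - f (a i)\<bar>) < \<epsilon>"
    using ac[unfolded abs_cont_on_def, rule_format, OF \<open>\<epsilon> > 0\<close>] by blast
  have "variation_sum f I u v < \<epsilon>"
    if fam: "interval_family S I u v" and len: "(\<Sum>i\<in>I. v i - u i) < \<delta>" for I :: "'i set" and u v
  proof -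
    obtain e where e: "bij_betw e {..<card I} I"
      using ex_bij_betw_nat_finite[OF interval_familyD(1)[OF fam]] by (auto simp: lessThan_atLeast0)
    have eI: "e i \<in> I" if "i < card I" for i
      using e that by (auto simp: bij_betw_def)
    have sums: "(\<Sum>i\<in>I. h i) = (\<Sum>i<card I. h (e i))" for h :: "'i \<Rightarrow> real"
      using sum.reindex_bij_betw[OF e, of h] by simp
    have inj: "e i \<noteq> e j" if "i < card I" "j < card I" "i \<noteq> j" for i j
      using e that by (auto simp: bij_betw_def inj_on_def)
    have 1: "\<forall>i<card I. u (e i) \<le> v (e i) \<and> {u (e i)..v (e i)} \<subseteq> S"
      using interval_familyD(2,3)[OF fam] eI by blast
    have 2: "\<forall>i<card I. \<forall>j<card I. i \<noteq> j \<longrightarrow> {u (e i)<..<v (e i)} \<inter> {u (e j)<..<v (e j)} = {}"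
      using interval_familyD(6)[OF fam] eI inj by blast
    show ?thesis
      using \<delta>[of "card I" "\<lambda>i. u (e i)" "\<lambda>i. v (e i)", OF 1 2] len
      unfolding variation_sum_def sums by blast
  qed
  with \<open>\<delta> > 0\<close> show ?thesis
    using that by blast
qed

text \<open>
  Indices in \<open>nat\<close> lose nothing, as families are finite, and always leave a fresh index for one more
  interval.
\<close>

definition total_variation :: "(real \<Rightarrow> real) \<Rightarrow> real \<Rightarrow> real \<Rightarrow> real" where
  "total_variation f a x =
     Sup {variation_sum f I u v |(I::nat set) u v. interval_family {a..x} I u v}"

text \<open>
  The \<open>\<delta>\<close> belonging to \<open>\<epsilon> = 1\<close> bounds the variation on any piece of length \<open>\<delta>/2\<close> by \<open>1\<close>, and
  finitely many such pieces cover \<open>{a..b}\<close>.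
\<close>

lemma abs_cont_on_bounded_variation:
  assumes ac: "abs_cont_on {a..b} f"
  obtains B where
    "\<And>(I::'i set) u v. interval_family {a..b} I u v \<Longrightarrow> variation_sum f I u v \<le> B"
proof (cases "a \<le> b")
  case False
  then have "variation_sum f I u v \<le> 0" if "interval_family {a..b} I u v" for I :: "'i set" and u v
    using that by (fastforce simp: interval_family_def variation_sum_def intro!: sum_nonpos)
  then show ?thesis using that by blast
next
  case True
  obtain \<delta> where "\<delta> > 0" and \<delta>:
    "\<And>(I::'i set) u v. interval_family {a..b} I u v \<Longrightarrow> (\<Sum>i\<in>I. v i - u i) < \<delta> \<Longrightarrow>
       variation_sum f I u v < 1"
    using abs_cont_on_family[OF ac, of 1] by auto
  have grow: "variation_sum f I u v \<le> real k"
    if "a \<le> x" "x \<le> b" "x - a \<le> real k * (\<delta>/2)" "interval_family {a..x} I u v"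
    for k x and I :: "'i set" and u v
    using that
  proof (induction k arbitrary: x u v)
    case 0
    then have "u i = x" "v i = x" if "i \<in> I" for i
      using interval_familyD(4,5)[OF 0(4)] that by fastforce+
    then show ?case by (simp add: variation_sum_def)
  next
    case (Suc k)
    \<comment> \<open>the last piece \<open>{y..x}\<close> has length at most \<open>\<delta>/2\<close>, the rest is handled by induction\<close>
    define y where "y = max a (x - \<delta>/2)"
    have y: "a \<le> y" "y \<le> x" "y \<le> b"
      using Suc \<open>\<delta> > 0\<close> by (auto simp: y_def)
    have xy: "x - y \<le> \<delta>/2"
      unfolding y_def using max.cobounded2[of "x - \<delta>/2" a] by linarith
    have "y - a \<le> real k * (\<delta>/2)"
      using Suc(4) \<open>\<delta> > 0\<close> unfolding y_def by (simp add: max_def algebra_simps)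
    then have 1: "variation_sum f I (\<lambda>i. min y (u i)) (\<lambda>i. min y (v i)) \<le> real k"
      using Suc.IH[OF y(1,3)] interval_family_clip_le[OF Suc(5) y(1)] by blast
    have fam: "interval_family {y..x} I (\<lambda>i. max y (u i)) (\<lambda>i. max y (v i))"
      using interval_family_clip_ge[OF Suc(5) y(2)] .
    have "(\<Sum>i\<in>I. max y (v i) - max y (u i)) \<le> x - y"
      using interval_family_length[OF fam subset_refl] y(2) by simp
    then have 2: "variation_sum f I (\<lambda>i. max y (u i)) (\<lambda>i. max y (v i)) < 1"
      using y xy Suc(3) \<open>\<delta> > 0\<close> by (intro \<delta> interval_family_mono[OF fam]) auto
    show ?case
      using variation_sum_clip[of f I u v y] 1 2 by simp
  qed
  obtain k where "(b - a) / (\<delta>/2) \<le> real k"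
    using real_arch_simple by blast
  then have "b - a \<le> real k * (\<delta>/2)"
    using \<open>\<delta> > 0\<close> by (simp add: field_simps)
  then show ?thesis
    using grow[of b k] True that by blast
qed

context
  fixes f :: "real \<Rightarrow> real" and a b :: real
  assumes ac: "abs_cont_on {a..b} f"
begin

lemma total_variation_upper:
  fixes I :: "nat set"
  assumes "x \<le> b" "interval_family {a..x} I u v"
  shows "variation_sum f I u v \<le> total_variation f a x"
proof -
  obtain B where B: "\<And>(I::nat set) u v. interval_family {a..b} I u v \<Longrightarrow> variation_sum f I u v \<le> B"
    using abs_cont_on_bounded_variation[OF ac] by blast
  have "bdd_above {variation_sum f I u v |(I::nat set) u v. interval_family {a..x} I u v}"
    using B interval_family_mono[of "{a..x}" _ _ _ "{a..b}"] \<open>x \<le> b\<close>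
    by (intro bdd_aboveI[of _ B]) fastforce
  then show ?thesis
    unfolding total_variation_def using assms by (intro cSup_upper) auto
qed

lemma total_variation_least:
  assumes "\<And>(I::nat set) u v. interval_family {a..x} I u v \<Longrightarrow> variation_sum f I u v \<le> B"
  shows "total_variation f a x \<le> B"
proof -
  have "interval_family {a..x} ({}::nat set) u u" for u
    by (simp add: interval_family_def)
  then show ?thesis
    unfolding total_variation_def using assms by (intro cSup_least) auto
qed

text \<open>
  Any family in \<open>{a..x}\<close> can be extended by the single interval \<open>{x..y}\<close>.
\<close>

lemma total_variation_increment:
  assumes "a \<le> x" "x \<le> y" "y \<le> b"
  shows "\<bar>f y - f x\<bar> \<le> total_variation f a y - total_variation f a x"
proof -
  have "total_variation f a x \<le> total_variation f a y - \<bar>f y - f x\<bar>"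
  proof (rule total_variation_least)
    fix I :: "nat set" and u v
    assume fam: "interval_family {a..x} I u v"
    obtain k where k: "k \<notin> I"
      using ex_new_if_finite[OF infinite_UNIV_nat interval_familyD(1)[OF fam]] by blast
    have bnd: "a \<le> u i" "v i \<le> x" if "i \<in> I" for i
      using interval_familyD(4,5)[OF fam that] by auto
    have dis: "{u i<..<v i} \<inter> {x<..<y} = {}" if "i \<in> I" for i
      using bnd(2)[OF that] by auto
    have "interval_family {a..y} (insert k I) (u(k := x)) (v(k := y))"
      using fam k assms dis bnd unfolding interval_family_def
      by (auto simp: disjoint_iff) (smt (verit))+
    then have "variation_sum f (insert k I) (u(k := x)) (v(k := y)) \<le> total_variation f a y"
      using assms by (intro total_variation_upper) auto
    moreover have "variation_sum f (insert k I) (u(k := x)) (v(k := y)) =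
        \<bar>f y - f x\<bar> + variation_sum f I u v"
      using k interval_familyD(1)[OF fam] unfolding variation_sum_def
      by (subst sum.insert) (auto intro!: sum.cong)
    ultimately show "variation_sum f I u v \<le> total_variation f a y - \<bar>f y - f x\<bar>"
      by simp
  qed
  then show ?thesis by simp
qed

text \<open>
  The variation over \<open>{x..y}\<close> itself nearly reaches the increment of the total variation: the part
  of a nearly optimal family of \<open>{a..y}\<close> that lies below \<open>x\<close> contributes at most the total variation at \<open>x\<close>.
\<close>

lemma total_variation_near_optimal:
  assumes "a \<le> x" "x \<le> y" "y \<le> b" "\<eta> > 0"
  obtains I :: "nat set" and u v where "interval_family {x..y} I u v"
    "total_variation f a y - total_variation f a x < variation_sum f I u v + \<eta>"
proof -
  have "\<not> total_variation f a y \<le> total_variation f a y - \<eta>"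
    using \<open>\<eta> > 0\<close> by simp
  then obtain I :: "nat set" and u v where fam: "interval_family {a..y} I u v"
    and opt: "total_variation f a y - \<eta> < variation_sum f I u v"
    using total_variation_least[of y "total_variation f a y - \<eta>"] by force
  have "variation_sum f I (\<lambda>i. min x (u i)) (\<lambda>i. min x (v i)) \<le> total_variation f a x"
    using assms by (intro total_variation_upper interval_family_clip_le[OF fam]) auto
  then have "total_variation f a y - total_variation f a x
      < variation_sum f I (\<lambda>i. max x (u i)) (\<lambda>i. max x (v i)) + \<eta>"
    using variation_sum_clip[of f I u v x] opt by simp
  with interval_family_clip_ge[OF fam \<open>x \<le> y\<close>] show ?thesis
    using that by blast
qed

text \<open>
  Replacing each interval of a given short family by a nearly optimal family inside it yields one large
  family that is no longer in total length, so the absolute continuity of \<open>f\<close> bounds its variation.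
\<close>

lemma abs_cont_on_total_variation: "abs_cont_on {a..b} (total_variation f a)"
  unfolding abs_cont_on_def
proof (intro allI impI)
  fix \<epsilon> :: real assume "\<epsilon> > 0"
  let ?V = "total_variation f a"
  obtain \<delta> where "\<delta> > 0" and \<delta>:
    "\<And>(I::(nat\<times>nat) set) u v. interval_family {a..b} I u v \<Longrightarrow> (\<Sum>i\<in>I. v i - u i) < \<delta> \<Longrightarrow>
       variation_sum f I u v < \<epsilon>/2"
    using abs_cont_on_family[OF ac, of "\<epsilon>/2"] \<open>\<epsilon> > 0\<close> by auto
  show "\<exists>\<delta>>0. \<forall>(N::nat) \<alpha> \<beta>.
        (\<forall>i<N. \<alpha> i \<le> \<beta> i \<and> {\<alpha> i..\<beta> i} \<subseteq> {a..b}) \<longrightarrow>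
        (\<forall>i<N. \<forall>j<N. i \<noteq> j \<longrightarrow> {\<alpha> i<..<\<beta> i} \<inter> {\<alpha> j<..<\<beta> j} = {}) \<longrightarrow>
        (\<Sum>i<N. \<beta> i - \<alpha> i) < \<delta> \<longrightarrow>
        (\<Sum>i<N. \<bar>?V (\<beta> i) - ?V (\<alpha> i)\<bar>) < \<epsilon>"
  proof (intro exI[of _ \<delta>] conjI \<open>\<delta> > 0\<close> allI impI)
    fix N :: nat and \<alpha> \<beta> :: "nat \<Rightarrow> real"
    assume sub: "\<forall>i<N. \<alpha> i \<le> \<beta> i \<and> {\<alpha> i..\<beta> i} \<subseteq> {a..b}"
      and dis: "\<forall>i<N. \<forall>j<N. i \<noteq> j \<longrightarrow> {\<alpha> i<..<\<beta> i} \<inter> {\<alpha> j<..<\<beta> j} = {}"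
      and len: "(\<Sum>i<N. \<beta> i - \<alpha> i) < \<delta>"
    have \<alpha>\<beta>: "a \<le> \<alpha> i" "\<alpha> i \<le> \<beta> i" "\<beta> i \<le> b" if "i < N" for i
      using sub that by auto
    define \<eta> where "\<eta> = \<epsilon> / (2 * (real N + 1))"
    have "\<eta> > 0" "real N * \<eta> < \<epsilon>/2"
      using \<open>\<epsilon> > 0\<close> by (auto simp: \<eta>_def field_simps)
    \<comment> \<open>an error of \<open>\<eta>\<close> in each of the \<open>N\<close> intervals adds up to less than \<open>\<epsilon>/2\<close>\<close>
    have "\<exists>I u v. interval_family {\<alpha> i..\<beta> i} (I :: nat set) u v \<and>
        ?V (\<beta> i) - ?V (\<alpha> i) < variation_sum f I u v + \<eta>" if "i < N" for i
      using total_variation_near_optimal[OF \<alpha>\<beta>[OF that] \<open>\<eta> > 0\<close>] by metis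
    then obtain I :: "nat \<Rightarrow> nat set" and u v where
      fam: "\<And>i. i < N \<Longrightarrow> interval_family {\<alpha> i..\<beta> i} (I i) (u i) (v i)" and
      opt: "\<And>i. i < N \<Longrightarrow> ?V (\<beta> i) - ?V (\<alpha> i) < variation_sum f (I i) (u i) (v i) + \<eta>"
      by metis
    let ?J = "SIGMA i:{..<N}. I i"
    let ?u = "\<lambda>(i, j). u i j" and ?v = "\<lambda>(i, j). v i j"
    have dis': "{u i j<..<v i j} \<inter> {u i' j'<..<v i' j'} = {}"
      if "i < N" "j \<in> I i" "i' < N" "j' \<in> I i'" "(i, j) \<noteq> (i', j')" for i j i' j'
    proof (cases "i = i'")
      case True
      then show ?thesis
        using interval_familyD(6)[OF fam[OF that(1)]] that by blast
    next
      case False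
      have "{u i j<..<v i j} \<subseteq> {\<alpha> i<..<\<beta> i}" "{u i' j'<..<v i' j'} \<subseteq> {\<alpha> i'<..<\<beta> i'}"
        using interval_familyD(4,5)[OF fam[OF that(1)] that(2)]
          interval_familyD(4,5)[OF fam[OF that(3)] that(4)] by auto
      moreover have "{\<alpha> i<..<\<beta> i} \<inter> {\<alpha> i'<..<\<beta> i'} = {}"
        using dis that False by blast
      ultimately show ?thesis by blast
    qed
    have fam': "interval_family {a..b} ?J ?u ?v"
      unfolding interval_family_def
    proof (intro conjI ballI impI)
      show "finite ?J"
        using interval_familyD(1)[OF fam] by auto
    next
      fix p assume "p \<in> ?J"
      then show "?u p \<le> ?v p" "{?u p..?v p} \<subseteq> {a..b}"
        using interval_familyD(2,4,5)[OF fam] \<alpha>\<beta> by fastforce+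
    next
      fix p q assume "p \<in> ?J" "q \<in> ?J" "p \<noteq> q"
      then show "{?u p<..<?v p} \<inter> {?u q<..<?v q} = {}"
        using dis'[of "fst p" "snd p" "fst q" "snd q"] by (auto simp: case_prod_beta)
    qed
    have fin: "\<forall>i\<in>{..<N}. finite (I i)"
      using interval_familyD(1)[OF fam] by auto
    have "(\<Sum>p\<in>?J. ?v p - ?u p) = (\<Sum>i<N. \<Sum>j\<in>I i. v i j - u i j)"
      using sum.Sigma[OF finite_lessThan fin, of "\<lambda>i j. v i j - u i j"]
      by (simp add: case_prod_beta)
    also have "\<dots> \<le> (\<Sum>i<N. \<beta> i - \<alpha> i)"
      using interval_family_length[OF fam subset_refl] \<alpha>\<beta>(2) by (intro sum_mono) fastforce
    finally have "variation_sum f ?J ?u ?v < \<epsilon>/2"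
      using len by (intro \<delta>[OF fam']) auto
    moreover have "variation_sum f ?J ?u ?v = (\<Sum>i<N. variation_sum f (I i) (u i) (v i))"
      unfolding variation_sum_def
      using sum.Sigma[OF finite_lessThan fin, of "\<lambda>i j. \<bar>f (v i j) - f (u i j)\<bar>"]
      by (simp add: case_prod_beta)
    moreover have "(\<Sum>i<N. \<bar>?V (\<beta> i) - ?V (\<alpha> i)\<bar>) \<le> (\<Sum>i<N. variation_sum f (I i) (u i) (v i) + \<eta>)"
      using opt total_variation_increment[OF \<alpha>\<beta>] by (intro sum_mono) fastforce
    ultimately show "(\<Sum>i<N. \<bar>?V (\<beta> i) - ?V (\<alpha> i)\<bar>) < \<epsilon>"
      using \<open>real N * \<eta> < \<epsilon>/2\<close> by (simp add: sum.distrib)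
  qed
qed

end

section \<open>Absolutely continuous functions are indefinite integrals\<close>

lemma abs_cont_on_diff:
  assumes "abs_cont_on S f" "abs_cont_on S g"
  shows "abs_cont_on S (\<lambda>x. f x - g x)"
  unfolding abs_cont_on_def
proof (intro allI impI)
  fix \<epsilon> :: real assume "\<epsilon> > 0"
  then have "\<epsilon>/2 > 0" by simp
  obtain d1 where d1: "d1 > 0" "\<And>(N::nat) a b.
        (\<forall>i<N. a i \<le> b i \<and> {a i..b i} \<subseteq> S) \<Longrightarrow>
        (\<forall>i<N. \<forall>j<N. i \<noteq> j \<longrightarrow> {a i<..<b i} \<inter> {a j<..<b j} = {}) \<Longrightarrow>
        (\<Sum>i<N. b i - a i) < d1 \<Longrightarrow> (\<Sum>i<N. \<bar>f (b i) - f (a i)\<bar>) < \<epsilon>/2"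
    using assms(1)[unfolded abs_cont_on_def, rule_format, OF \<open>\<epsilon>/2 > 0\<close>] by blast
  obtain d2 where d2: "d2 > 0" "\<And>(N::nat) a b.
        (\<forall>i<N. a i \<le> b i \<and> {a i..b i} \<subseteq> S) \<Longrightarrow>
        (\<forall>i<N. \<forall>j<N. i \<noteq> j \<longrightarrow> {a i<..<b i} \<inter> {a j<..<b j} = {}) \<Longrightarrow>
        (\<Sum>i<N. b i - a i) < d2 \<Longrightarrow> (\<Sum>i<N. \<bar>g (b i) - g (a i)\<bar>) < \<epsilon>/2"
    using assms(2)[unfolded abs_cont_on_def, rule_format, OF \<open>\<epsilon>/2 > 0\<close>] by blast
  have "(\<Sum>i<N. \<bar>f (b i) - g (b i) - (f (a i) - g (a i))\<bar>) < \<epsilon>"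
    if h: "\<forall>i<N. a i \<le> b i \<and> {a i..b i} \<subseteq> S"
        "\<forall>i<N. \<forall>j<N. i \<noteq> j \<longrightarrow> {a i<..<b i} \<inter> {a j<..<b j} = {}"
        "(\<Sum>i<N. b i - a i) < min d1 d2" for N :: nat and a b
  proof -
    have "(\<Sum>i<N. \<bar>f (b i) - g (b i) - (f (a i) - g (a i))\<bar>)
        \<le> (\<Sum>i<N. \<bar>f (b i) - f (a i)\<bar> + \<bar>g (b i) - g (a i)\<bar>)"
      by (intro sum_mono) auto
    also have "\<dots> < \<epsilon>"
      using d1(2)[OF h(1,2)] d2(2)[OF h(1,2)] h(3) by (simp add: sum.distrib)
    finally show ?thesis .
  qed
  then show "\<exists>\<delta>>0. \<forall>(N::nat) a b.
        (\<forall>i<N. a i \<le> b i \<and> {a i..b i} \<subseteq> S) \<longrightarrow>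
        (\<forall>i<N. \<forall>j<N. i \<noteq> j \<longrightarrow> {a i<..<b i} \<inter> {a j<..<b j} = {}) \<longrightarrow>
        (\<Sum>i<N. b i - a i) < \<delta> \<longrightarrow>
        (\<Sum>i<N. \<bar>f (b i) - g (b i) - (f (a i) - g (a i))\<bar>) < \<epsilon>"
    using d1(1) d2(1) by (intro exI[of _ "min d1 d2"]) auto
qed

text \<open>
  Freezing a function outside \<open>{a..b}\<close> makes it absolutely continuous on the whole line, which is
  where Stieltjes measures live.
\<close>

lemma abs_cont_on_clamp:
  assumes ac: "abs_cont_on {a..b} f" and "a \<le> b"
  shows "abs_cont_on UNIV (\<lambda>x. f (max a (min b x)))"
  unfolding abs_cont_on_def
proof (intro allI impI)
  fix \<epsilon> :: real assume "\<epsilon> > 0"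
  obtain \<delta> where "\<delta> > 0" and \<delta>:
    "\<And>(I::nat set) u v. interval_family {a..b} I u v \<Longrightarrow> (\<Sum>i\<in>I. v i - u i) < \<delta> \<Longrightarrow>
       variation_sum f I u v < \<epsilon>"
    using abs_cont_on_family[OF ac \<open>\<epsilon> > 0\<close>] by blast
  have "(\<Sum>i<N. \<bar>f (max a (min b (v i))) - f (max a (min b (u i)))\<bar>) < \<epsilon>"
    if h: "\<forall>i<N. u i \<le> v i \<and> {u i..v i} \<subseteq> UNIV"
        "\<forall>i<N. \<forall>j<N. i \<noteq> j \<longrightarrow> {u i<..<v i} \<inter> {u j<..<v j} = {}"
        "(\<Sum>i<N. v i - u i) < \<delta>" for N :: nat and u v
  proof -
    have fam: "interval_family UNIV {..<N} u v"
      using h(1,2) by (simp add: interval_family_def)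
    have "(\<Sum>i<N. max a (min b (v i)) - max a (min b (u i))) \<le> (\<Sum>i<N. v i - u i)"
      using h(1) by (intro sum_mono) (auto simp: max_def min_def)
    then show ?thesis
      using \<delta>[OF interval_family_clip[OF fam \<open>a \<le> b\<close>]] h(3) by (simp add: variation_sum_def)
  qed
  then show "\<exists>\<delta>>0. \<forall>(N::nat) u v.
        (\<forall>i<N. u i \<le> v i \<and> {u i..v i} \<subseteq> UNIV) \<longrightarrow>
        (\<forall>i<N. \<forall>j<N. i \<noteq> j \<longrightarrow> {u i<..<v i} \<inter> {u j<..<v j} = {}) \<longrightarrow>
        (\<Sum>i<N. v i - u i) < \<delta> \<longrightarrow>
        (\<Sum>i<N. \<bar>f (max a (min b (v i))) - f (max a (min b (u i)))\<bar>) < \<epsilon>"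
    using \<open>\<delta> > 0\<close> by blast
qed

lemma abs_cont_on_imp_continuous_on:
  assumes "abs_cont_on UNIV f"
  shows "continuous_on UNIV f"
  unfolding continuous_on_iff
proof (intro ballI allI impI)
  fix x \<epsilon> :: real assume "\<epsilon> > 0"
  obtain \<delta> where "\<delta> > 0" and \<delta>:
    "\<And>(I::nat set) u v. interval_family UNIV I u v \<Longrightarrow> (\<Sum>i\<in>I. v i - u i) < \<delta> \<Longrightarrow>
       variation_sum f I u v < \<epsilon>"
    using abs_cont_on_family[OF assms \<open>\<epsilon> > 0\<close>] by blast
  have "dist (f y) (f x) < \<epsilon>" if "dist y x < \<delta>" for y
    using \<delta>[of "{0}" "\<lambda>_. min x y" "\<lambda>_. max x y"] that
    by (cases "x \<le> y") (auto simp: interval_family_def variation_sum_def dist_real_def)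
  with \<open>\<delta> > 0\<close> show "\<exists>d>0. \<forall>x'\<in>UNIV. dist x' x < d \<longrightarrow> dist (f x') (f x) < \<epsilon>"
    by blast
qed

text \<open>
  A bounded null set lies in an open set of measure less than \<open>\<delta>\<close>, and is covered by countably many
  nonoverlapping compact intervals inside that open set. Finitely many of them have Stieltjes measure
  less than \<open>\<epsilon>\<close> by absolute continuity, and so their union has measure at most \<open>\<epsilon>\<close>.
\<close>

lemma interval_measure_absolutely_continuous:
  assumes F: "mono F" and ac: "abs_cont_on UNIV F"
  shows "absolutely_continuous lborel (interval_measure F)"
proof -
  let ?\<mu> = "interval_measure F"
  have Icc: "emeasure ?\<mu> {x..y} = ennreal (F y - F x)" if "x \<le> y" for x y
    using emeasure_interval_measure_Icc[OF that _ abs_cont_on_imp_continuous_on[OF ac]] monoD[OF F] by blast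
  have bounded_null: "emeasure ?\<mu> S = 0"
    if S: "S \<in> null_sets lborel" and Sk: "S \<subseteq> cbox (-k) k" "k > 0" for S and k :: real
  proof -
    have "emeasure ?\<mu> S \<le> ennreal \<epsilon>" if "\<epsilon> > 0" for \<epsilon>
    proof -
      obtain \<delta> where "\<delta> > 0" and \<delta>:
        "\<And>(I::real set set) u v. interval_family UNIV I u v \<Longrightarrow> (\<Sum>i\<in>I. v i - u i) < \<delta> \<Longrightarrow>
           variation_sum F I u v < \<epsilon>"
        using abs_cont_on_family[OF ac \<open>\<epsilon> > 0\<close>] by blast
      have "S \<in> null_sets lebesgue"
        using S null_sets_completionI by blast
      then obtain U where U: "open U" "S \<subseteq> U" "U - S \<in> lmeasurable"
          "emeasure lebesgue (U - S) < ennreal \<delta>"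
        using sets_lebesgue_outer_open[OF _ \<open>\<delta> > 0\<close>] by blast
      have "U = (U - S) \<union> S"
        using U(2) by blast
      moreover have "(U - S) \<union> S \<in> lmeasurable"
        using U(3) fmeasurableI_null_sets[OF \<open>S \<in> null_sets lebesgue\<close>] by (rule fmeasurable.Un)
      moreover have "emeasure lebesgue ((U - S) \<union> S) = emeasure lebesgue (U - S)"
        using emeasure_Un_null_set[OF fmeasurableD[OF U(3)] \<open>S \<in> null_sets lebesgue\<close>] .
      ultimately have Um: "U \<in> lmeasurable" "emeasure lebesgue U < ennreal \<delta>"
        using U(4) by simp_all
      then have Um\<delta>: "measure lebesgue U < \<delta>"
        using \<open>\<delta> > 0\<close> by (simp add: emeasure_eq_measure2 ennreal_less_iff)
      \<comment> \<open>with this gauge, every covering interval that is tagged by a point of \<open>S\<close> lies in \<open>U\<close>\<close>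
      have gauge: "gauge (\<lambda>x. if x \<in> U then U else UNIV)"
        using U(1) by (auto simp: gauge_def)
      have box: "box (- k) k \<noteq> {}"
        using Sk(2) by simp
      obtain D where D: "countable D"
          "\<And>K. K \<in> D \<Longrightarrow> interior K \<noteq> {} \<and> (\<exists>c d. K = cbox c d)"
          "pairwise (\<lambda>A B. interior A \<inter> interior B = {}) D"
          "\<And>K. K \<in> D \<Longrightarrow> \<exists>x \<in> S \<inter> K. K \<subseteq> (if x \<in> U then U else UNIV)" "S \<subseteq> \<Union>D"
        by (rule covering_lemma[OF Sk(1) box gauge]) blast
      have DU: "K \<subseteq> U" if "K \<in> D" for K
        using D(4)[OF that] U(2) by (auto split: if_splits)
      \<comment> \<open>the covering intervals index themselves, with endpoints \<open>Inf K\<close> and \<open>Sup K\<close>\<close>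
      have Kform: "{Inf K..Sup K} = K \<and> Inf K \<le> Sup K" if KD: "K \<in> D" for K
      proof -
        obtain c d where K: "K = {c..d}"
          using D(2)[OF KD] by auto
        then have "c \<le> d"
          using D(2)[OF KD] by force
        then show ?thesis using K by simp
      qed
      have finite_bound: "emeasure ?\<mu> (\<Union>E) \<le> ennreal \<epsilon>" if E: "finite E" "E \<subseteq> D" for E
      proof -
        have int: "interior K = {Inf K<..<Sup K}" if "K \<in> D" for K
          using Kform[OF that] interior_atLeastAtMost_real[of "Inf K" "Sup K"] by simp
        have "{Inf K<..<Sup K} \<inter> {Inf L<..<Sup L} = {}" if "K \<in> E" "L \<in> E" "K \<noteq> L" for K L
          using pairwiseD[OF D(3), of K L] int[of K] int[of L] E(2) that by auto
        then have fam: "interval_family U E Inf Sup"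
          using E Kform DU unfolding interval_family_def by (auto simp: subset_iff)
        have "variation_sum F E Inf Sup < \<epsilon>"
          using interval_family_length[OF fam subset_refl Um(1)] Um\<delta>
          by (intro \<delta>[OF interval_family_mono[OF fam]]) auto
        have "emeasure ?\<mu> (\<Union>K\<in>E. {Inf K..Sup K}) \<le> (\<Sum>K\<in>E. emeasure ?\<mu> {Inf K..Sup K})"
          using E by (intro emeasure_subadditive_finite) auto
        also have "\<dots> = (\<Sum>K\<in>E. ennreal \<bar>F (Sup K) - F (Inf K)\<bar>)"
        proof (intro sum.cong refl)
          fix K assume "K \<in> E"
          then have "Inf K \<le> Sup K"
            using Kform E(2) by blast
          then show "emeasure ?\<mu> {Inf K..Sup K} = ennreal \<bar>F (Sup K) - F (Inf K)\<bar>"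
            using Icc[of "Inf K" "Sup K"] monoD[OF F, of "Inf K" "Sup K"] by simp
        qed
        also have "\<dots> = ennreal (variation_sum F E Inf Sup)"
          by (simp add: variation_sum_def)
        also have "\<dots> \<le> ennreal \<epsilon>"
          using \<open>variation_sum F E Inf Sup < \<epsilon>\<close> by (intro ennreal_leI) simp
        also have "(\<Union>K\<in>E. {Inf K..Sup K}) = \<Union>E"
          using Kform E(2) by (intro SUP_cong[where D="\<lambda>K. K" and B=E, simplified]) auto
        finally show ?thesis .
      qed
      have Dm: "K \<in> sets borel" if "K \<in> D" for K
        using Kform[OF that] borel_closed[OF closed_atLeastAtMost[of "Inf K" "Sup K"]] by simp
      show ?thesis
      proof (cases "D = {}")
        case True
        then show ?thesis using D(5) by simp
      next
        case False
        define e where "e = from_nat_into D"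
        have e: "range e = D"
          using D(1) False by (simp add: e_def range_from_nat_into)
        define A where "A n = \<Union>(e ` {..<n})" for n :: nat
        have "emeasure ?\<mu> S \<le> emeasure ?\<mu> (\<Union>n. A n)"
        proof (rule emeasure_mono)
          show "S \<subseteq> (\<Union>n. A n)"
          proof
            fix x assume "x \<in> S"
            then obtain K where "x \<in> K" "K \<in> range e"
              using D(5) e by auto
            then obtain i where "x \<in> e i" by auto
            then have "x \<in> A (Suc i)"
              unfolding A_def by blast
            then show "x \<in> (\<Union>n. A n)"
              by blast
          qed
        qed (use Dm e in \<open>auto simp: A_def\<close>)
        also have "\<dots> = (SUP n. emeasure ?\<mu> (A n))"
        proof (rule SUP_emeasure_incseq[symmetric])
          show "range A \<subseteq> sets ?\<mu>"
            using Dm e by (auto simp: A_def)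
          show "incseq A"
            unfolding A_def incseq_def by (intro allI impI Union_mono image_mono) auto
        qed
        also have "\<dots> \<le> ennreal \<epsilon>"
          using e unfolding A_def by (intro SUP_least finite_bound) auto
        finally show ?thesis .
      qed
    qed
    then have "emeasure ?\<mu> S \<le> 0"
      by - (rule ennreal_le_epsilon, simp)
    then show ?thesis by simp
  qed
  show ?thesis
    unfolding absolutely_continuous_def
  proof
    fix S :: "real set" assume S: "S \<in> null_sets lborel"
    have "emeasure ?\<mu> (S \<inter> {- real (Suc k)..real (Suc k)}) = 0" for k
      by (rule bounded_null[OF null_set_Int2[OF S], of _ "real (Suc k)"]) auto
    then have "emeasure ?\<mu> (\<Union>k. S \<inter> {- real (Suc k)..real (Suc k)}) = 0"
      using S by (intro emeasure_UN_eq_0) auto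
    moreover have "(\<Union>k. S \<inter> {- real (Suc k)..real (Suc k)}) = S"
    proof -
      have "\<exists>k. x \<in> {- real (Suc k)..real (Suc k)}" for x :: real
      proof -
        obtain k :: nat where "\<bar>x\<bar> \<le> real k"
          using real_arch_simple by blast
        then show ?thesis
          by (intro exI[of _ k]) auto
      qed
      then show ?thesis by blast
    qed
    ultimately show "S \<in> null_sets ?\<mu>"
      using S by (auto simp: null_sets_def)
  qed
qed

text \<open>
  The integrand is the Radon--Nikodym density of the Stieltjes measure of \<open>F\<close>. The density may be
  infinite on a null set; there \<open>enn2real\<close> replaces it by zero.
\<close>

lemma mono_abs_cont_integral:
  assumes F: "mono F" and ac: "abs_cont_on UNIV F"
  obtains \<psi> where "\<And>x y. x \<le> y \<Longrightarrow> (\<psi> has_integral F y - F x) {x..y}"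
proof -
  let ?\<mu> = "interval_measure F"
  have Icc: "emeasure ?\<mu> {x..y} = ennreal (F y - F x)" if "x \<le> y" for x y
    using emeasure_interval_measure_Icc[OF that _ abs_cont_on_imp_continuous_on[OF ac]] monoD[OF F] by blast
  obtain \<phi> where \<phi>: "\<phi> \<in> borel_measurable lborel" "density lborel \<phi> = ?\<mu>"
    using sigma_finite_measure.Radon_Nikodym[OF sigma_finite_lborel interval_measure_absolutely_continuous[OF assms]] by auto
  define \<psi> where "\<psi> x = enn2real (\<phi> x)" for x
  have "(\<psi> has_integral F y - F x) {x..y}" if "x \<le> y" for x y
  proof -
    have int: "(\<integral>\<^sup>+z. \<phi> z * indicator {x..y} z \<partial>lborel) = ennreal (F y - F x)"
      using \<phi> Icc[OF that] by (metis emeasure_density sets_lborel borel_closed closed_atLeastAtMost)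
    have "AE z in lborel. \<phi> z * indicator {x..y} z \<noteq> \<infinity>"
      using \<phi>(1) int by (intro nn_integral_PInf_AE) auto
    then have "AE z in lborel. ennreal (\<psi> z * indicator {x..y} z) = \<phi> z * indicator {x..y} z"
      by eventually_elim (auto simp: \<psi>_def indicator_def less_top)
    then have "(\<integral>\<^sup>+z. ennreal (\<psi> z * indicator {x..y} z) \<partial>lborel) = ennreal (F y - F x)"
      using int nn_integral_cong_AE by metis
    moreover have "(\<lambda>z. \<psi> z * indicator {x..y} z) \<in> borel_measurable borel"
      using \<phi>(1) unfolding \<psi>_def by measurable
    ultimately have "((\<lambda>z. \<psi> z * indicator {x..y} z) has_integral F y - F x) UNIV"
      using monoD[OF F that] by (intro nn_integral_has_integral) (auto simp: \<psi>_def)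
    then show ?thesis
      by (subst has_integral_restrict_UNIV[symmetric])
        (simp add: indicator_def of_bool_def if_distrib cong: if_cong)
  qed
  then show ?thesis using that by blast
qed

text \<open>
  The fundamental theorem of calculus for absolutely continuous functions: \<open>f\<close> is the difference of
  its total variation \<open>V\<close> and \<open>V - f\<close>, both of which are monotone and absolutely continuous.
\<close>

theorem abs_cont_on_has_integral:
  assumes ac: "abs_cont_on {a..b} f" and "a \<le> b"
  obtains \<psi> where "\<And>x y. a \<le> x \<Longrightarrow> x \<le> y \<Longrightarrow> y \<le> b \<Longrightarrow> (\<psi> has_integral f y - f x) {x..y}"
proof -
  let ?V = "total_variation f a"
  define k where "k x = max a (min b x)" for x
  have k: "a \<le> k x" "k x \<le> b" "x \<le> y \<Longrightarrow> k x \<le> k y" for x y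
    using \<open>a \<le> b\<close> by (auto simp: k_def max_def min_def)
  have acV: "abs_cont_on {a..b} ?V"
    using abs_cont_on_total_variation[OF ac] .
  have inc: "\<bar>f (k y) - f (k x)\<bar> \<le> ?V (k y) - ?V (k x)" if "x \<le> y" for x y
    using total_variation_increment[OF ac k(1) k(3)[OF that] k(2)] .
  have m1: "mono (\<lambda>x. ?V (k x))"
  proof (rule monoI)
    fix x y :: real assume "x \<le> y"
    show "?V (k x) \<le> ?V (k y)"
      using inc[OF \<open>x \<le> y\<close>] by linarith
  qed
  have m2: "mono (\<lambda>x. ?V (k x) - f (k x))"
  proof (rule monoI)
    fix x y :: real assume "x \<le> y"
    show "?V (k x) - f (k x) \<le> ?V (k y) - f (k y)"
      using inc[OF \<open>x \<le> y\<close>] by linarith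
  qed
  have a1: "abs_cont_on UNIV (\<lambda>x. ?V (k x))"
    using abs_cont_on_clamp[OF acV \<open>a \<le> b\<close>] by (simp add: k_def)
  have a2: "abs_cont_on UNIV (\<lambda>x. ?V (k x) - f (k x))"
    using abs_cont_on_clamp[OF abs_cont_on_diff[OF acV ac] \<open>a \<le> b\<close>] by (simp add: k_def)
  obtain \<psi>1 where \<psi>1:
      "\<And>x y. x \<le> y \<Longrightarrow> (\<psi>1 has_integral ?V (k y) - ?V (k x)) {x..y}"
    by (rule mono_abs_cont_integral[OF m1 a1]) blast
  obtain \<psi>2 where \<psi>2:
      "\<And>x y. x \<le> y \<Longrightarrow> (\<psi>2 has_integral (?V (k y) - f (k y)) - (?V (k x) - f (k x))) {x..y}"
    by (rule mono_abs_cont_integral[OF m2 a2]) blast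
  have "((\<lambda>z. \<psi>1 z - \<psi>2 z) has_integral f y - f x) {x..y}" if "a \<le> x" "x \<le> y" "y \<le> b" for x y
  proof -
    have "k x = x" "k y = y"
      using that by (auto simp: k_def)
    then show ?thesis
      using has_integral_diff[OF \<psi>1 \<psi>2, OF that(2,2)] by simp
  qed
  then show ?thesis using that by blast
qed

section \<open>Lebesgue differentiation of indefinite integrals\<close>

text \<open>
  The proposition \<open>integrable_ccontinuous_explicit\<close> is the statement for averages to the right of a
  point. Averages to the left follow by applying it to the reflected function.
\<close>

theorem lebesgue_differentiation_two_sided:
  fixes f :: "real \<Rightarrow> real"
  assumes f: "f integrable_on {a..b}"
  obtains N where "negligible N"
    "\<And>s. s \<in> {a<..<b} - N \<Longrightarrow> ((\<lambda>z. integral {s..s+z} f / z) \<longlongrightarrow> f s) (at_right 0)"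
    "\<And>s. s \<in> {a<..<b} - N \<Longrightarrow> ((\<lambda>z. integral {s-z..s} f / z) \<longlongrightarrow> f s) (at_right 0)"
proof -
  define g where "g x = (if x \<in> {a..b} then f x else 0)" for x
  have "g integrable_on UNIV"
    using f unfolding g_def by (simp only: integrable_restrict_UNIV)
  then have g: "g integrable_on cbox x y" for x y
    by (rule integrable_on_subcbox) auto
  then have g': "(\<lambda>x. g (-x)) integrable_on cbox x y" for x y
    using Henstock_Kurzweil_Integration.integrable_reflect_real[of g "-x" "-y"] by simp
  obtain N1 where N1: "negligible N1" "\<And>x e. \<lbrakk>x \<notin> N1; 0 < e\<rbrakk> \<Longrightarrow>
      \<exists>d>0. \<forall>h. 0 < h \<and> h < d \<longrightarrow> norm (integral (cbox x (x + h *\<^sub>R One)) g /\<^sub>R h ^ DIM(real) - g x) < e"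
    using integrable_ccontinuous_explicit[OF g] by blast
  obtain N2 where N2: "negligible N2" "\<And>x e. \<lbrakk>x \<notin> N2; 0 < e\<rbrakk> \<Longrightarrow>
      \<exists>d>0. \<forall>h. 0 < h \<and> h < d \<longrightarrow>
        norm (integral (cbox x (x + h *\<^sub>R One)) (\<lambda>x. g (-x)) /\<^sub>R h ^ DIM(real) - g (-x)) < e"
    using integrable_ccontinuous_explicit[OF g'] by blast
  show ?thesis
  proof (rule that)
    show "negligible (N1 \<union> uminus ` N2)"
      using N1(1) N2(1) by (auto intro!: negligible_Un negligible_differentiable_image_negligible differentiable_on_minus)
  next
    fix s assume s: "s \<in> {a<..<b} - (N1 \<union> uminus ` N2)"
    have gs: "g s = f s" using s by (simp add: g_def)
    have ev: "\<forall>\<^sub>F z in at_right 0. 0 < z \<and> z < b - s \<and> z < s - a"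
      unfolding eventually_at_right_field using s by (intro exI[of _ "min (b - s) (s - a)"]) auto
    have "((\<lambda>z. integral {s..s+z} g / z) \<longlongrightarrow> g s) (at_right 0)"
    proof (rule tendstoI)
      fix e :: real assume "e > 0"
      then show "\<forall>\<^sub>F z in at_right 0. dist (integral {s..s+z} g / z) (g s) < e"
        using N1(2)[of s e] s unfolding eventually_at_right_field
        by (auto simp: dist_real_def divide_inverse mult.commute)
    qed
    moreover have "\<forall>\<^sub>F z in at_right 0. integral {s..s+z} g / z = integral {s..s+z} f / z"
      using ev
    proof eventually_elim
      case (elim z)
      then have "integral {s..s+z} g = integral {s..s+z} f"
        using s by (intro integral_cong) (auto simp: g_def)
      then show ?case by simp
    qed
    ultimately show "((\<lambda>z. integral {s..s+z} f / z) \<longlongrightarrow> f s) (at_right 0)"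
      unfolding gs by (rule Lim_transform_eventually)
    have "- s \<notin> N2" using s by force
    have "((\<lambda>z. integral {s-z..s} g / z) \<longlongrightarrow> g s) (at_right 0)"
    proof (rule tendstoI)
      fix e :: real assume "e > 0"
      have "integral {-s..-s+z} (\<lambda>x. g (-x)) = integral {s-z..s} g" for z
        using Henstock_Kurzweil_Integration.integral_reflect_real[of s "s-z" g] by simp
      then show "\<forall>\<^sub>F z in at_right 0. dist (integral {s-z..s} g / z) (g s) < e"
        using N2(2)[OF \<open>- s \<notin> N2\<close> \<open>e > 0\<close>] unfolding eventually_at_right_field
        by (auto simp: dist_real_def divide_inverse mult.commute)
    qed
    moreover have "\<forall>\<^sub>F z in at_right 0. integral {s-z..s} g / z = integral {s-z..s} f / z"
      using ev
    proof eventually_elim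
      case (elim z)
      then have "integral {s-z..s} g = integral {s-z..s} f"
        using s by (intro integral_cong) (auto simp: g_def)
      then show ?case by simp
    qed
    ultimately show "((\<lambda>z. integral {s-z..s} f / z) \<longlongrightarrow> f s) (at_right 0)"
      unfolding gs by (rule Lim_transform_eventually)
  qed
qed

text \<open>
  The second difference is the difference of the integrals of the density over \<open>{s..s + z}\<close> and
  \<open>{s - z..s}\<close>, which are both asymptotic to \<open>z\<close> times the value of the density at \<open>s\<close>.
\<close>

lemma abs_cont_on_second_difference:
  assumes f: "abs_cont_on {a..b} f" and "a \<le> b"
  obtains N where "negligible N"
    "\<And>s. s \<in> {a<..<b} - N \<Longrightarrow>
       ((\<lambda>z. (f (s + z) + f (s - z) - 2 * f s) / z) \<longlongrightarrow> 0) (at_right 0)"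
proof -
  obtain \<psi> where \<psi>: "\<And>u v. a \<le> u \<Longrightarrow> u \<le> v \<Longrightarrow> v \<le> b \<Longrightarrow> (\<psi> has_integral f v - f u) {u..v}"
    by (rule abs_cont_on_has_integral[OF f \<open>a \<le> b\<close>]) blast
  have "\<psi> integrable_on {a..b}"
    using \<psi>[of a b] \<open>a \<le> b\<close> by (auto simp: has_integral_integrable)
  then obtain N where N: "negligible N"
    "\<And>s. s \<in> {a<..<b} - N \<Longrightarrow> ((\<lambda>z. integral {s..s+z} \<psi> / z) \<longlongrightarrow> \<psi> s) (at_right 0)"
    "\<And>s. s \<in> {a<..<b} - N \<Longrightarrow> ((\<lambda>z. integral {s-z..s} \<psi> / z) \<longlongrightarrow> \<psi> s) (at_right 0)"
    using lebesgue_differentiation_two_sided[of \<psi> a b] by blast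
  have "((\<lambda>z. (f (s + z) + f (s - z) - 2 * f s) / z) \<longlongrightarrow> 0) (at_right 0)" if s: "s \<in> {a<..<b} - N" for s
  proof -
    have "((\<lambda>z. integral {s..s+z} \<psi> / z - integral {s-z..s} \<psi> / z) \<longlongrightarrow> \<psi> s - \<psi> s) (at_right 0)"
      by (intro tendsto_intros N s)
    moreover have "\<forall>\<^sub>F z in at_right 0. integral {s..s+z} \<psi> / z - integral {s-z..s} \<psi> / z
        = (f (s + z) + f (s - z) - 2 * f s) / z"
      unfolding eventually_at_right_field
    proof (intro exI[of _ "min (s - a) (b - s)"] conjI allI impI)
      show "0 < min (s - a) (b - s)" using s by auto
      fix z assume "0 < z" "z < min (s - a) (b - s)"
      then have "integral {s..s+z} \<psi> = f (s + z) - f s" "integral {s-z..s} \<psi> = f s - f (s - z)"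
        using s \<psi>[of s "s + z"] \<psi>[of "s - z" s] by (auto intro!: integral_unique)
      then show "integral {s..s+z} \<psi> / z - integral {s-z..s} \<psi> / z
          = (f (s + z) + f (s - z) - 2 * f s) / z"
        by (simp add: diff_divide_distrib[symmetric])
    qed
    ultimately show ?thesis
      using Lim_transform_eventually by fastforce
  qed
  with N(1) show ?thesis using that by blast
qed

lemma lebesgue_differentiation_symmetric:
  fixes n :: "real \<Rightarrow> real"
  assumes n_int: "n integrable_on {a..b}"
  obtains N where "negligible N"
    "\<And>s. s \<in> {a<..<b} - N \<Longrightarrow>
       ((\<lambda>z. integral {s - z..s + z} n / z) \<longlongrightarrow> 2 * n s) (at_right 0)"
proof -
  obtain N where N: "negligible N"
    "\<And>s. s \<in> {a<..<b} - N \<Longrightarrow> ((\<lambda>z. integral {s..s+z} n / z) \<longlongrightarrow> n s) (at_right 0)"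
    "\<And>s. s \<in> {a<..<b} - N \<Longrightarrow> ((\<lambda>z. integral {s-z..s} n / z) \<longlongrightarrow> n s) (at_right 0)"
    using lebesgue_differentiation_two_sided[OF n_int] by blast
  have "((\<lambda>z. integral {s - z..s + z} n / z) \<longlongrightarrow> 2 * n s) (at_right 0)" if s: "s \<in> {a<..<b} - N" for s
  proof -
    have "((\<lambda>z. integral {s-z..s} n / z + integral {s..s+z} n / z) \<longlongrightarrow> n s + n s) (at_right 0)"
      by (intro tendsto_intros N s)
    moreover have "\<forall>\<^sub>F z in at_right 0. integral {s-z..s} n / z + integral {s..s+z} n / z
        = integral {s - z..s + z} n / z"
      unfolding eventually_at_right_field
    proof (intro exI[of _ "min (s - a) (b - s)"] conjI allI impI)
      show "0 < min (s - a) (b - s)" using s by auto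
      fix z assume z: "0 < z" "z < min (s - a) (b - s)"
      have "n integrable_on {s - z..s + z}"
        by (rule integrable_on_subinterval[OF n_int]) (use z in auto)
      then have "integral {s - z..s} n + integral {s..s + z} n = integral {s - z..s + z} n"
        by (intro Henstock_Kurzweil_Integration.integral_combine) (use z in auto)
      then show "integral {s-z..s} n / z + integral {s..s+z} n / z = integral {s - z..s + z} n / z"
        by (simp add: add_divide_distrib[symmetric])
    qed
    ultimately show ?thesis
      using Lim_transform_eventually by fastforce
  qed
  with N(1) show ?thesis using that by blast
qed

section \<open>The domain and integrals with variable limits\<close>

definition wedge :: "real \<Rightarrow> (real \<times> real) set" where
  "wedge c = {(s, t). 0 \<le> s \<and> 0 \<le> t \<and> c \<le> s + t}"

text \<open>
  Every point of the wedge is approached from inside along the direction \<open>(1, 1)\<close>.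
\<close>

lemma closure_Omega: "closure (Omega c) = wedge c"
proof
  have "closed (wedge c)"
    unfolding wedge_def case_prod_beta
    by (intro closed_Collect_conj closed_Collect_le continuous_intros)
  then show "closure (Omega c) \<subseteq> wedge c"
    by (intro closure_minimal) (auto simp: Omega_def wedge_def)
  show "wedge c \<subseteq> closure (Omega c)"
  proof
    fix p assume p: "p \<in> wedge c"
    show "p \<in> closure (Omega c)"
      unfolding closure_approachable
    proof (intro allI impI)
      fix e :: real assume "e > 0"
      have "p + (e/4, e/4) \<in> Omega c"
        using p \<open>e > 0\<close> by (cases p) (auto simp: Omega_def wedge_def)
      moreover have "dist (p + (e/4, e/4)) p < e"
        using \<open>e > 0\<close> norm_Pair_le[of "e/4" "e/4"] by (simp add: dist_norm)
      ultimately show "\<exists>y\<in>Omega c. dist y p < e" by blast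
    qed
  qed
qed

lemma integral_unit_interval:
  fixes f :: "real \<Rightarrow> real"
  assumes "a \<le> b" "continuous_on {a..b} f"
  shows "integral {a..b} f = (b - a) * integral {0..1} (\<lambda>u. f (a + u * (b - a)))"
proof (cases "a = b")
  case False
  then have "b - a > 0" using \<open>a \<le> b\<close> by simp
  have "(f has_integral integral {a..b} f) (cbox a b)"
    using integrable_integral[OF integrable_continuous_real[OF assms(2)]] by simp
  from has_integral_affinity'[OF this \<open>b - a > 0\<close>, of a]
  have "((\<lambda>u. f (a + u * (b - a))) has_integral integral {a..b} f / (b - a)) {0..1}"
    using \<open>b - a > 0\<close> by (simp add: ac_simps divide_inverse)
  then show ?thesis
    using \<open>b - a > 0\<close> by (simp add: integral_unique)
qed simp

text \<open>
  The substitution of \<open>integral_unit_interval\<close> moves the variable limits into the integrand, leaving a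
  parametric integral over the fixed interval \<open>{0..1}\<close>.
\<close>

lemma continuous_on_integral_variable_limits:
  fixes k :: "'a::topological_space \<Rightarrow> real \<Rightarrow> real"
  assumes k: "continuous_on (SIGMA p:U. {a p..b p}) (\<lambda>(p, \<sigma>). k p \<sigma>)"
    and a: "continuous_on U a" and b: "continuous_on U b"
    and ab: "\<And>p. p \<in> U \<Longrightarrow> a p \<le> b p"
  shows "continuous_on U (\<lambda>p. integral {a p..b p} (k p))"
proof -
  have seg: "a p + u * (b p - a p) \<in> {a p..b p}" if "p \<in> U" "u \<in> {0..1}" for p u
    using that ab[OF that(1)] mult_left_le_one_le[of "b p - a p" u] by auto
  have "continuous_on (U \<times> cbox 0 1) (\<lambda>(p, u). k p (a p + u * (b p - a p)))"
  proof -
    have "continuous_on (U \<times> cbox 0 1) (\<lambda>z. (fst z, a (fst z) + snd z * (b (fst z) - a (fst z))))"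
      by (intro continuous_intros continuous_on_compose2[OF a] continuous_on_compose2[OF b]) auto
    from continuous_on_compose2[OF k this] show ?thesis
      using seg by (fastforce simp: case_prod_beta)
  qed
  then have "continuous_on U (\<lambda>p. integral {0..1} (\<lambda>u. k p (a p + u * (b p - a p))))"
    using integral_continuous_on_param[of U 0 1 "\<lambda>p u. k p (a p + u * (b p - a p))"] by simp
  then have "continuous_on U (\<lambda>p. (b p - a p) * integral {0..1} (\<lambda>u. k p (a p + u * (b p - a p))))"
    by (intro continuous_intros a b)
  moreover have "integral {a p..b p} (k p) =
      (b p - a p) * integral {0..1} (\<lambda>u. k p (a p + u * (b p - a p)))" if "p \<in> U" for p
  proof (rule integral_unit_interval[OF ab[OF that]])
    show "continuous_on {a p..b p} (k p)"
      using continuous_on_compose2[OF k, of "{a p..b p}" "\<lambda>\<sigma>. (p, \<sigma>)"] that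
      by (simp add: continuous_on_Pair image_subset_iff)
  qed
  ultimately show ?thesis by simp
qed

section \<open>A Volterra equation in two variables\<close>

text \<open>
  The right-hand side of the Volterra equation for a general forcing \<open>F\<close>, with kernels that factor
  into a coefficient \<open>A (s + t)\<close> and a function \<open>m\<close> of the coordinate sum along the segment.
\<close>

definition volterra_rhs ::
    "real \<Rightarrow> (real \<times> real \<Rightarrow> real) \<Rightarrow> (real \<Rightarrow> real) \<Rightarrow> (real \<Rightarrow> real) \<Rightarrow>
      (real \<times> real \<Rightarrow> real) \<Rightarrow> real \<times> real \<Rightarrow> real" where
  "volterra_rhs c F A m x = (\<lambda>(s, t). F (s, t) + A (s + t) *
     (integral {max (c - t) 0..s} (\<lambda>\<sigma>. m (\<sigma> + t) * x (\<sigma>, t)) +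
      integral {max (c - s) 0..t} (\<lambda>\<tau>. m (s + \<tau>) * x (s, \<tau>))))"

text \<open>
  The bounded pieces on which the fixed-point argument runs. They are compact and convex, and they
  contain the integration segments of each of their points.
\<close>

definition truncated_wedge :: "real \<Rightarrow> real \<Rightarrow> (real \<times> real) set" where
  "truncated_wedge c R = {(s, t). 0 \<le> s \<and> 0 \<le> t \<and> c \<le> s + t \<and> s \<le> R \<and> t \<le> R}"

lemma volterra_rhs_cong:
  assumes "(s, t) \<in> truncated_wedge c R" "\<And>p. p \<in> truncated_wedge c R \<Longrightarrow> x p = y p"
  shows "volterra_rhs c F A m x (s, t) = volterra_rhs c F A m y (s, t)"
proof -
  have "integral {max (c - t) 0..s} (\<lambda>\<sigma>. m (\<sigma> + t) * x (\<sigma>, t)) =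
      integral {max (c - t) 0..s} (\<lambda>\<sigma>. m (\<sigma> + t) * y (\<sigma>, t))"
    using assms by (intro integral_cong arg_cong2[where f="(*)"] refl) (auto simp: truncated_wedge_def)
  moreover have "integral {max (c - s) 0..t} (\<lambda>\<tau>. m (s + \<tau>) * x (s, \<tau>)) =
      integral {max (c - s) 0..t} (\<lambda>\<tau>. m (s + \<tau>) * y (s, \<tau>))"
    using assms by (intro integral_cong arg_cong2[where f="(*)"] refl) (auto simp: truncated_wedge_def)
  ultimately show ?thesis
    by (simp add: volterra_rhs_def)
qed

text \<open>
  Integrating the weight produces the factor \<open>1 / M\<close> that makes the Volterra operator a contraction.
\<close>

lemma integral_exp_weight_bound:
  fixes u v :: "real \<Rightarrow> real"
  assumes "M > 0" "E \<ge> 0" and u: "continuous_on {a..s} u" and v: "continuous_on {a..s} v"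
    and le: "\<And>\<sigma>. \<sigma> \<in> {a..s} \<Longrightarrow> \<bar>u \<sigma> - v \<sigma>\<bar> \<le> E * exp (M * \<sigma>)"
  shows "\<bar>integral {a..s} u - integral {a..s} v\<bar> \<le> E * exp (M * s) / M"
proof (cases "a \<le> s")
  case True
  have "((\<lambda>\<sigma>. E * exp (M * \<sigma>)) has_integral (E * exp (M * s) / M - E * exp (M * a) / M)) {a..s}"
    using \<open>M > 0\<close>
    by (intro fundamental_theorem_of_calculus[OF True])
      (auto intro!: derivative_eq_intros simp: has_real_derivative_iff_has_vector_derivative[symmetric])
  note I = this
  have "integral {a..s} u - integral {a..s} v = integral {a..s} (\<lambda>\<sigma>. u \<sigma> - v \<sigma>)"
    using u v by (simp add: integral_diff integrable_continuous_real)
  also have "\<bar>\<dots>\<bar> \<le> integral {a..s} (\<lambda>\<sigma>. E * exp (M * \<sigma>))"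
    using integral_norm_bound_integral[of "\<lambda>\<sigma>. u \<sigma> - v \<sigma>" "{a..s}" "\<lambda>\<sigma>. E * exp (M * \<sigma>)"] u v le I
    by (simp add: integrable_diff integrable_continuous_real has_integral_integrable)
  also have "\<dots> \<le> E * exp (M * s) / M"
    unfolding integral_unique[OF I] using \<open>M > 0\<close> \<open>E \<ge> 0\<close> by simp
  finally show ?thesis .
qed (use assms in auto)

context
  fixes c :: real and F :: "real \<times> real \<Rightarrow> real" and A m :: "real \<Rightarrow> real"
  assumes c: "c > 0" and F: "continuous_on (wedge c) F"
    and A: "continuous_on {c..} A" and m: "continuous_on {c..} m"
begin

lemma truncated_wedge_sub: "truncated_wedge c R \<subseteq> wedge c"
  by (auto simp: truncated_wedge_def wedge_def)

lemma continuous_horizontal_integrand: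
  assumes x: "continuous_on (truncated_wedge c R) x"
  shows "continuous_on (SIGMA p:truncated_wedge c R. {max (c - snd p) 0..fst p})
           (\<lambda>(p, \<sigma>). m (\<sigma> + snd p) * x (\<sigma>, snd p))"
  unfolding case_prod_beta
  by (intro continuous_intros continuous_on_compose2[OF m] continuous_on_compose2[OF x])
    (auto simp: truncated_wedge_def)

lemma continuous_vertical_integrand:
  assumes x: "continuous_on (truncated_wedge c R) x"
  shows "continuous_on (SIGMA p:truncated_wedge c R. {max (c - fst p) 0..snd p})
           (\<lambda>(p, \<tau>). m (fst p + \<tau>) * x (fst p, \<tau>))"
  unfolding case_prod_beta
  by (intro continuous_intros continuous_on_compose2[OF m] continuous_on_compose2[OF x])
    (auto simp: truncated_wedge_def)

lemma continuous_volterra_rhs: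
  assumes x: "continuous_on (truncated_wedge c R) x"
  shows "continuous_on (truncated_wedge c R) (volterra_rhs c F A m x)"
proof -
  let ?D = "truncated_wedge c R"
  have 1: "continuous_on ?D (\<lambda>p. integral {max (c - snd p) 0..fst p} (\<lambda>\<sigma>. m (\<sigma> + snd p) * x (\<sigma>, snd p)))"
    by (intro continuous_on_integral_variable_limits continuous_horizontal_integrand[OF x] continuous_intros)
      (auto simp: truncated_wedge_def)
  have 2: "continuous_on ?D (\<lambda>p. integral {max (c - fst p) 0..snd p} (\<lambda>\<tau>. m (fst p + \<tau>) * x (fst p, \<tau>)))"
    by (intro continuous_on_integral_variable_limits continuous_vertical_integrand[OF x] continuous_intros)
      (auto simp: truncated_wedge_def)
  show ?thesis
    unfolding volterra_rhs_def case_prod_beta prod.collapse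
    by (intro continuous_intros 1 2 continuous_on_compose2[OF A] continuous_on_subset[OF F truncated_wedge_sub])
      (auto simp: truncated_wedge_def)
qed

lemma volterra_rhs_weighted_lipschitz:
  assumes x: "continuous_on (truncated_wedge c R) x" and y: "continuous_on (truncated_wedge c R) y"
    and B: "\<And>r. r \<in> {c..2*R} \<Longrightarrow> \<bar>A r\<bar> \<le> B" and C: "\<And>r. r \<in> {c..2*R} \<Longrightarrow> \<bar>m r\<bar> \<le> C"
    and "B \<ge> 0" "C \<ge> 0" "M > 0" "d \<ge> 0"
    and le: "\<And>s t. (s, t) \<in> truncated_wedge c R \<Longrightarrow> \<bar>x (s, t) - y (s, t)\<bar> \<le> d * exp (M * (s + t))"
    and st: "(s, t) \<in> truncated_wedge c R"
  shows "\<bar>volterra_rhs c F A m x (s, t) - volterra_rhs c F A m y (s, t)\<bar>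
           \<le> 2 * B * C / M * d * exp (M * (s + t))"
proof -
  let ?D = "truncated_wedge c R"
  have h: "(\<sigma>, t) \<in> ?D" "\<sigma> + t \<in> {c..2*R}" if "\<sigma> \<in> {max (c - t) 0..s}" for \<sigma>
    using that st by (auto simp: truncated_wedge_def)
  have v: "(s, \<tau>) \<in> ?D" "s + \<tau> \<in> {c..2*R}" if "\<tau> \<in> {max (c - s) 0..t}" for \<tau>
    using that st by (auto simp: truncated_wedge_def)
  have ch: "continuous_on {max (c - t) 0..s} (\<lambda>\<sigma>. m (\<sigma> + t) * w (\<sigma>, t))"
    if "continuous_on ?D w" for w
    using h by (intro continuous_intros continuous_on_compose2[OF m] continuous_on_compose2[OF that]) auto
  have cv: "continuous_on {max (c - s) 0..t} (\<lambda>\<tau>. m (s + \<tau>) * w (s, \<tau>))"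
    if "continuous_on ?D w" for w
    using v by (intro continuous_intros continuous_on_compose2[OF m] continuous_on_compose2[OF that]) auto
  let ?ih = "\<lambda>w. integral {max (c - t) 0..s} (\<lambda>\<sigma>. m (\<sigma> + t) * w (\<sigma>, t))"
  let ?iv = "\<lambda>w. integral {max (c - s) 0..t} (\<lambda>\<tau>. m (s + \<tau>) * w (s, \<tau>))"
  have 1: "\<bar>?ih x - ?ih y\<bar> \<le> (C * d * exp (M * t)) * exp (M * s) / M"
  proof (rule integral_exp_weight_bound[OF \<open>M > 0\<close> _ ch[OF x] ch[OF y]])
    fix \<sigma> assume \<sigma>: "\<sigma> \<in> {max (c - t) 0..s}"
    have "\<bar>m (\<sigma> + t) * x (\<sigma>, t) - m (\<sigma> + t) * y (\<sigma>, t)\<bar> = \<bar>m (\<sigma> + t)\<bar> * \<bar>x (\<sigma>, t) - y (\<sigma>, t)\<bar>"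
      by (simp add: abs_mult right_diff_distrib[symmetric])
    also have "\<dots> \<le> C * (d * exp (M * (\<sigma> + t)))"
      using h[OF \<sigma>] C le \<open>C \<ge> 0\<close> by (intro mult_mono) auto
    finally show "\<bar>m (\<sigma> + t) * x (\<sigma>, t) - m (\<sigma> + t) * y (\<sigma>, t)\<bar> \<le> C * d * exp (M * t) * exp (M * \<sigma>)"
      by (simp add: distrib_left exp_add mult_ac)
  qed (use \<open>C \<ge> 0\<close> \<open>d \<ge> 0\<close> in auto)
  have 2: "\<bar>?iv x - ?iv y\<bar> \<le> (C * d * exp (M * s)) * exp (M * t) / M"
  proof (rule integral_exp_weight_bound[OF \<open>M > 0\<close> _ cv[OF x] cv[OF y]])
    fix \<tau> assume \<tau>: "\<tau> \<in> {max (c - s) 0..t}"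
    have "\<bar>m (s + \<tau>) * x (s, \<tau>) - m (s + \<tau>) * y (s, \<tau>)\<bar> = \<bar>m (s + \<tau>)\<bar> * \<bar>x (s, \<tau>) - y (s, \<tau>)\<bar>"
      by (simp add: abs_mult right_diff_distrib[symmetric])
    also have "\<dots> \<le> C * (d * exp (M * (s + \<tau>)))"
      using v[OF \<tau>] C le \<open>C \<ge> 0\<close> by (intro mult_mono) auto
    finally show "\<bar>m (s + \<tau>) * x (s, \<tau>) - m (s + \<tau>) * y (s, \<tau>)\<bar> \<le> C * d * exp (M * s) * exp (M * \<tau>)"
      by (simp add: distrib_left exp_add mult_ac)
  qed (use \<open>C \<ge> 0\<close> \<open>d \<ge> 0\<close> in auto)
  have "volterra_rhs c F A m x (s, t) - volterra_rhs c F A m y (s, t)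
      = A (s + t) * ((?ih x - ?ih y) + (?iv x - ?iv y))"
    by (simp add: volterra_rhs_def algebra_simps)
  moreover have "\<bar>A (s + t)\<bar> \<le> B"
    by (rule B) (use st in \<open>simp add: truncated_wedge_def\<close>)
  moreover have "\<bar>?ih x - ?ih y\<bar> \<le> C * d * exp (M * (s + t)) / M"
    using 1 by (simp add: distrib_left exp_add mult_ac)
  moreover have "\<bar>?iv x - ?iv y\<bar> \<le> C * d * exp (M * (s + t)) / M"
    using 2 by (simp add: distrib_left exp_add mult_ac)
  moreover have "\<bar>a * (p + q)\<bar> \<le> B * (2 * e)" if "\<bar>a\<bar> \<le> B" "\<bar>p\<bar> \<le> e" "\<bar>q\<bar> \<le> e" for a p q e :: real
    unfolding abs_mult using that by (intro mult_mono) auto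
  ultimately have "\<bar>volterra_rhs c F A m x (s, t) - volterra_rhs c F A m y (s, t)\<bar>
      \<le> B * (2 * (C * d * exp (M * (s + t)) / M))"
    by presburger
  then show ?thesis
    by (simp add: mult_ac)
qed

text \<open>
  The weighted operator acts on the complete space of bounded continuous functions on the whole plane;
  precomposing with the nearest-point projection onto the compact convex piece turns functions on the
  piece into such functions. A fixed point \<open>\<phi>\<close> corresponds to the solution \<open>exp (M * (s + t)) * \<phi> (s, t)\<close>.
\<close>

lemma volterra_local:
  assumes R: "R \<ge> c"
  shows "\<exists>x. continuous_on (truncated_wedge c R) x \<and>
           (\<forall>p\<in>truncated_wedge c R. x p = volterra_rhs c F A m x p) \<and>
           (\<forall>y. continuous_on (truncated_wedge c R) y \<and>
                (\<forall>p\<in>truncated_wedge c R. y p = volterra_rhs c F A m y p) \<longrightarrow>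
                (\<forall>p\<in>truncated_wedge c R. y p = x p))"
proof -
  let ?D = "truncated_wedge c R"
  have closed: "closed ?D"
    unfolding truncated_wedge_def case_prod_beta
    by (intro closed_Collect_conj closed_Collect_le continuous_intros)
  have "?D \<subseteq> cbox (0, 0) (R, R)"
    by (auto simp: truncated_wedge_def)
  then have "bounded ?D"
    using bounded_cbox bounded_subset by blast
  with closed have compact: "compact ?D"
    by (simp add: compact_eq_bounded_closed)
  have convex: "convex ?D"
  proof -
    have "?D = {p. fst p \<ge> 0} \<inter> {p. snd p \<ge> 0} \<inter> {p. (1, 1) \<bullet> p \<ge> c} \<inter> {p. fst p \<le> R} \<inter> {p. snd p \<le> R}"
      by (auto simp: truncated_wedge_def)
    also have "\<dots> = {p. (1, 0) \<bullet> p \<ge> 0} \<inter> {p. (0, 1) \<bullet> p \<ge> 0} \<inter> {p. (1, 1) \<bullet> p \<ge> c} \<inter>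
        {p. (1, 0) \<bullet> p \<le> R} \<inter> {p. (0, 1) \<bullet> p \<le> R}"
      by (auto simp: inner_prod_def)
    also have "convex \<dots>"
      by (intro convex_Int convex_halfspace_ge convex_halfspace_le)
    finally show ?thesis .
  qed
  have "(c, 0) \<in> ?D"
    using c R by (auto simp: truncated_wedge_def)
  then have ne: "?D \<noteq> {}" by blast
  define P where "P = closest_point ?D"
  have P: "P p \<in> ?D" for p
    unfolding P_def using closed ne by (rule closest_point_in_set)
  have PD: "P p = p" if "p \<in> ?D" for p
    unfolding P_def using that by (rule closest_point_self)
  have Pc: "continuous_on UNIV P"
    unfolding P_def using convex closed ne by (rule continuous_on_closest_point)
  have bdd: "\<exists>B. \<forall>r\<in>{c..2*R}. \<bar>w r\<bar> \<le> B" if "continuous_on {c..} w" for w :: "real \<Rightarrow> real"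
  proof -
    have "compact (w ` {c..2*R})"
      by (intro compact_continuous_image continuous_on_subset[OF that]) auto
    from compact_imp_bounded[OF this] show ?thesis
      by (simp add: bounded_iff)
  qed
  obtain B where B: "\<And>r. r \<in> {c..2*R} \<Longrightarrow> \<bar>A r\<bar> \<le> B"
    using bdd[OF A] by blast
  obtain C where C: "\<And>r. r \<in> {c..2*R} \<Longrightarrow> \<bar>m r\<bar> \<le> C"
    using bdd[OF m] by blast
  have B0: "B \<ge> 0" and C0: "C \<ge> 0"
    using B[of c] C[of c] R c by auto
  \<comment> \<open>large enough for the Lipschitz constant \<open>2 * B * C / M\<close> to be at most one half\<close>
  define M where "M = 4 * B * C + 1"
  have M: "M > 0" "2 * B * C / M \<le> 1/2"
    using B0 C0 by (auto simp: M_def divide_simps add_nonneg_pos)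
  define w where "w p = exp (M * (fst p + snd p))" for p :: "real \<times> real"
  have wc: "continuous_on S w" for S
    unfolding w_def by (intro continuous_intros)
  have w0: "w p > 0" for p
    by (simp add: w_def)
  define T where "T \<phi> p = volterra_rhs c F A m (\<lambda>q. w q * \<phi> q) (P p) / w (P p)" for \<phi> p
  have Tb: "T \<phi> \<in> bcontfun" if "continuous_on UNIV \<phi>" for \<phi>
  proof -
    have "continuous_on ?D (\<lambda>p. volterra_rhs c F A m (\<lambda>q. w q * \<phi> q) p / w p)"
      using w0 by (intro continuous_intros continuous_volterra_rhs wc continuous_on_subset[OF that])
        (auto simp: less_imp_neq[THEN not_sym])
    note rc = this
    have "continuous_on UNIV (T \<phi>)"
      unfolding T_def by (rule continuous_on_compose2[OF rc Pc]) (use P in auto)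
    moreover have "range (T \<phi>) \<subseteq> (\<lambda>p. volterra_rhs c F A m (\<lambda>q. w q * \<phi> q) p / w p) ` ?D"
      using P by (auto simp: T_def)
    then have "bounded (range (T \<phi>))"
      using compact_imp_bounded[OF compact_continuous_image[OF rc compact]] bounded_subset by blast
    ultimately show ?thesis by (simp add: bcontfun_def)
  qed
  define \<T> where "\<T> \<phi> = Bcontfun (T (apply_bcontfun \<phi>))" for \<phi> :: "(real \<times> real) \<Rightarrow>\<^sub>C real"
  have \<T>: "apply_bcontfun (\<T> \<phi>) = T (apply_bcontfun \<phi>)" for \<phi>
    unfolding \<T>_def by (intro Bcontfun_inverse Tb continuous_on_apply_bcontfun)
  have contr: "dist (\<T> \<phi>) (\<T> \<psi>) \<le> 1/2 * dist \<phi> \<psi>" for \<phi> \<psi>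
  proof (rule dist_bound)
    fix p
    obtain s t where st: "P p = (s, t)" by fastforce
    have "\<bar>w (s', t') * apply_bcontfun \<phi> (s', t') - w (s', t') * apply_bcontfun \<psi> (s', t')\<bar>
        \<le> dist \<phi> \<psi> * exp (M * (s' + t'))" for s' t'
    proof -
      have "\<bar>w (s', t') * apply_bcontfun \<phi> (s', t') - w (s', t') * apply_bcontfun \<psi> (s', t')\<bar>
          = w (s', t') * dist (apply_bcontfun \<phi> (s', t')) (apply_bcontfun \<psi> (s', t'))"
        using w0[of "(s', t')"] by (simp add: dist_real_def abs_mult right_diff_distrib[symmetric])
      also have "\<dots> \<le> w (s', t') * dist \<phi> \<psi>"
        using w0[of "(s', t')"] by (intro mult_left_mono dist_bounded) auto
      finally show ?thesis by (simp add: w_def mult.commute)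
    qed
    then have "\<bar>volterra_rhs c F A m (\<lambda>q. w q * apply_bcontfun \<phi> q) (s, t) -
        volterra_rhs c F A m (\<lambda>q. w q * apply_bcontfun \<psi> q) (s, t)\<bar>
        \<le> 2 * B * C / M * dist \<phi> \<psi> * exp (M * (s + t))"
      using P[of p] st
      by (intro volterra_rhs_weighted_lipschitz[where R=R] B C B0 C0 M(1) continuous_intros wc) auto
    also have "\<dots> \<le> 1/2 * dist \<phi> \<psi> * w (s, t)"
      using mult_right_mono[OF M(2), of "dist \<phi> \<psi> * exp (M * (s + t))"]
      by (simp only: w_def fst_conv snd_conv mult.assoc) simp
    finally have "\<bar>volterra_rhs c F A m (\<lambda>q. w q * apply_bcontfun \<phi> q) (s, t) -
        volterra_rhs c F A m (\<lambda>q. w q * apply_bcontfun \<psi> q) (s, t)\<bar> / w (s, t) \<le> 1/2 * dist \<phi> \<psi>"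
      using w0[of "(s, t)"] by (simp add: divide_simps)
    then show "dist (apply_bcontfun (\<T> \<phi>) p) (apply_bcontfun (\<T> \<psi>) p) \<le> 1/2 * dist \<phi> \<psi>"
      using w0[of "(s, t)"]
      by (simp add: \<T> T_def st dist_real_def diff_divide_distrib[symmetric] abs_divide)
  qed
  have "\<exists>!\<phi>. \<T> \<phi> = \<phi>"
    by (rule banach_fix_type[of "1/2"]) (use contr in auto)
  then obtain \<phi> where \<phi>: "\<T> \<phi> = \<phi>" and uniq: "\<And>\<psi>. \<T> \<psi> = \<psi> \<Longrightarrow> \<psi> = \<phi>" by blast
  let ?x = "\<lambda>q. w q * apply_bcontfun \<phi> q"
  show ?thesis
  proof (intro exI[of _ ?x] conjI ballI allI impI)
    show "continuous_on ?D ?x"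
      by (intro continuous_intros wc) auto
  next
    fix p assume p: "p \<in> ?D"
    have "apply_bcontfun \<phi> p = volterra_rhs c F A m ?x p / w p"
      using arg_cong[OF \<phi>, of "\<lambda>\<psi>. apply_bcontfun \<psi> p"] PD[OF p] by (simp add: \<T> T_def)
    then show "?x p = volterra_rhs c F A m ?x p"
      using w0[of p] by (simp add: field_simps)
  next
    fix y p assume y: "continuous_on ?D y \<and> (\<forall>p\<in>?D. y p = volterra_rhs c F A m y p)" and p: "p \<in> ?D"
    define h where "h p = y (P p) / w (P p)" for p
    have hc: "continuous_on UNIV h"
      unfolding h_def
    proof (rule continuous_on_compose2[OF _ Pc])
      show "continuous_on ?D (\<lambda>p. y p / w p)"
        using y w0 by (intro continuous_intros wc) (auto simp: less_imp_neq[THEN not_sym])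
    qed (use P in auto)
    have Th: "T h = h"
    proof
      fix p
      obtain s t where st: "P p = (s, t)" by fastforce
      have "volterra_rhs c F A m (\<lambda>q. w q * h q) (s, t) = volterra_rhs c F A m y (s, t)"
        using P[of p] PD w0 unfolding st h_def
        by (intro volterra_rhs_cong) (auto simp: less_imp_neq[THEN not_sym])
      then show "T h p = h p"
        using y P[of p] by (simp add: T_def h_def st)
    qed
    have hb: "h \<in> bcontfun"
      using Tb[OF hc] Th by simp
    have "\<T> (Bcontfun h) = Bcontfun h"
      unfolding \<T>_def Bcontfun_inverse[OF hb] Th ..
    then have "apply_bcontfun \<phi> = h"
      using uniq Bcontfun_inverse[OF hb] by metis
    then show "y p = ?x p"
      using PD[OF p] w0[of p] by (simp add: h_def)
  qed
qed

text \<open>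
  By uniqueness the solutions on two pieces agree on the smaller one, so evaluating at each point the
  solution of some piece around it defines a global solution. It is continuous because near every point
  of the wedge it coincides with the solution of a single piece.
\<close>

theorem volterra_global:
  "\<exists>x. continuous_on (wedge c) x \<and> (\<forall>p\<in>wedge c. x p = volterra_rhs c F A m x p) \<and>
       (\<forall>y. continuous_on (wedge c) y \<and> (\<forall>p\<in>wedge c. y p = volterra_rhs c F A m y p) \<longrightarrow>
            (\<forall>p\<in>wedge c. y p = x p))"
proof -
  let ?D = "truncated_wedge c"
  define sol where "sol R x \<longleftrightarrow>
      continuous_on (?D R) x \<and> (\<forall>p\<in>?D R. x p = volterra_rhs c F A m x p)" for R x
  have local: "\<exists>x. sol R x \<and> (\<forall>y. sol R y \<longrightarrow> (\<forall>p\<in>?D R. y p = x p))" if "c \<le> R" for R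
    unfolding sol_def conj_assoc by (rule volterra_local[OF that])
  have "\<forall>R. \<exists>x. c \<le> R \<longrightarrow> sol R x \<and> (\<forall>y. sol R y \<longrightarrow> (\<forall>p\<in>?D R. y p = x p))"
    using local by blast
  from choice[OF this] obtain X where
    XX: "\<forall>R. c \<le> R \<longrightarrow> sol R (X R) \<and> (\<forall>y. sol R y \<longrightarrow> (\<forall>p\<in>?D R. y p = X R p))"
    by (rule exE)
  have X: "sol R (X R)" if "c \<le> R" for R
    using XX that by blast
  have uniq: "y p = X R p" if "c \<le> R" "sol R y" "p \<in> ?D R" for R y p
    using XX that by blast
  have sol_eq: "X R p = volterra_rhs c F A m (X R) p" if "c \<le> R" "p \<in> ?D R" for R p
    using X[OF that(1)] that(2) unfolding sol_def by blast
  have mono: "?D R \<subseteq> ?D R'" if "R \<le> R'" for R R'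
    using that by (auto simp: truncated_wedge_def)
  have agree: "X R' p = X R p" if "c \<le> R" "R \<le> R'" "p \<in> ?D R" for R R' p
  proof (rule uniq[OF that(1) _ that(3)])
    have "sol R' (X R')"
      by (rule X) (use that in simp)
    then show "sol R (X R')"
      using mono[OF that(2)] continuous_on_subset[of "?D R'" "X R'" "?D R"]
      unfolding sol_def by blast
  qed
  \<comment> \<open>the summand 1 puts \<open>p\<close> strictly below the truncation, as continuity at \<open>p\<close> requires\<close>
  define r where "r p = c + \<bar>fst p\<bar> + \<bar>snd p\<bar> + 1" for p :: "real \<times> real"
  have r: "c \<le> r p" for p by (simp add: r_def)
  have rD: "p \<in> ?D (r p)" if "p \<in> wedge c" for p
    using that c by (auto simp: r_def truncated_wedge_def wedge_def)
  define x where "x p = X (r p) p" for p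
  have xX: "x p = X R p" if "p \<in> ?D R" "c \<le> R" for p R
  proof -
    have p: "p \<in> ?D (r p)"
      using that(1) truncated_wedge_sub rD by blast
    show ?thesis
      using agree[OF that(2) _ that(1), of "max R (r p)"] agree[OF r _ p, of "max R (r p)"]
      by (simp add: x_def)
  qed
  show ?thesis
  proof (intro exI[of _ x] conjI ballI allI impI)
    show "continuous_on (wedge c) x"
      unfolding continuous_on_eq_continuous_within
    proof
      fix p assume p: "p \<in> wedge c"
      let ?U = "{q. fst q < r p \<and> snd q < r p} :: (real \<times> real) set"
      have "open ?U"
        by (intro open_Collect_conj open_Collect_less continuous_intros)
      have "p \<in> ?U"
        unfolding r_def mem_Collect_eq using c by linarith
      have nhd: "at p within ?D (r p) = at p within wedge c"
        by (rule at_within_nhd[OF \<open>p \<in> ?U\<close> \<open>open ?U\<close>]) (auto simp: truncated_wedge_def wedge_def)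
      have "continuous_on (?D (r p)) (X (r p))"
        using X[OF r[of p]] unfolding sol_def by blast
      then have "continuous_on (?D (r p)) x"
        by (rule continuous_on_eq) (use xX[OF _ r[of p]] in simp)
      then have "continuous (at p within ?D (r p)) x"
        using rD[OF p] by (simp add: continuous_on_eq_continuous_within)
      then show "continuous (at p within wedge c) x"
        unfolding continuous_within nhd .
    qed
  next
    fix p assume p: "p \<in> wedge c"
    obtain s t where st: "p = (s, t)" by fastforce
    have "volterra_rhs c F A m x (s, t) = volterra_rhs c F A m (X (r p)) (s, t)"
      using rD[OF p] xX[OF _ r[of p]] unfolding st by (intro volterra_rhs_cong) auto
    then show "x p = volterra_rhs c F A m x p"
      using sol_eq[OF r rD[OF p]] xX[OF rD[OF p] r] st by metis
  next
    fix y p assume y: "continuous_on (wedge c) y \<and> (\<forall>p\<in>wedge c. y p = volterra_rhs c F A m y p)"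
      and p: "p \<in> wedge c"
    have "sol (r p) y"
      using y truncated_wedge_sub[of "r p"] continuous_on_subset unfolding sol_def by blast
    from uniq[OF r this rD[OF p]] show "y p = x p"
      by (simp add: x_def)
  qed
qed

end

section \<open>Uniqueness along an edge and averages over shrinking intervals\<close>

text \<open>
  Writing \<open>I s\<close> for the integral, \<open>I' = lam' * w\<close> and \<open>I = 2 * lam * w\<close> give
  \<open>(I\<^sup>2 / lam)' = I * lam' * (2 * lam * w - I) / lam\<^sup>2 = 0\<close>. As \<open>I c = 0\<close>, both \<open>I\<close> and \<open>w\<close> vanish.
\<close>

lemma zero_of_homogeneous_edge_equation:
  fixes lam w :: "real \<Rightarrow> real"
  assumes lam: "\<And>r. r \<ge> c \<Longrightarrow> (lam has_real_derivative lam' r) (at r)"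
    and nz: "\<And>r. r \<ge> c \<Longrightarrow> lam r \<noteq> 0"
    and lam': "continuous_on {c..} lam'" and w: "continuous_on {c..} w"
    and eq: "\<And>s. s \<ge> c \<Longrightarrow> 2 * lam s * w s = integral {c..s} (\<lambda>\<sigma>. lam' \<sigma> * w \<sigma>)"
    and s: "s \<ge> c"
  shows "w s = 0"
proof -
  define I where "I u = integral {c..u} (\<lambda>\<sigma>. lam' \<sigma> * w \<sigma>)" for u
  have eqI: "2 * lam u * w u = I u" if "u \<ge> c" for u
    using eq[OF that] by (simp add: I_def)
  have "((\<lambda>u. (I u)\<^sup>2 / lam u) has_real_derivative 0) (at u within {c..s})" if u: "u \<in> {c..s}" for u
  proof -
    have cont: "continuous_on {c..s} (\<lambda>\<sigma>. lam' \<sigma> * w \<sigma>)"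
      by (intro continuous_intros continuous_on_subset[OF lam'] continuous_on_subset[OF w]) auto
    have I: "(I has_real_derivative lam' u * w u) (at u within {c..s})"
      unfolding I_def using integral_has_real_derivative[OF cont u] .
    have L: "(lam has_real_derivative lam' u) (at u within {c..s})"
      using lam[of u] u has_field_derivative_at_within by auto
    have "lam u \<noteq> 0"
      using nz u by simp
    have "((\<lambda>u. (I u)\<^sup>2 / lam u) has_real_derivative
        ((2 * (lam' u * w u) * I u) * lam u - (I u)\<^sup>2 * lam' u) / (lam u * lam u)) (at u within {c..s})"
      using DERIV_divide[OF DERIV_power[OF I, of 2] L \<open>lam u \<noteq> 0\<close>] by (simp add: mult_ac)
    moreover have "(2 * (lam' u * w u) * I u) * lam u - (I u)\<^sup>2 * lam' u
        = I u * lam' u * (2 * lam u * w u - I u)"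
      by (simp add: algebra_simps power2_eq_square)
    then have "(2 * (lam' u * w u) * I u) * lam u - (I u)\<^sup>2 * lam' u = 0"
      using eqI[of u] u by simp
    ultimately show ?thesis by simp
  qed
  then obtain k where k: "\<And>u. u \<in> {c..s} \<Longrightarrow> (I u)\<^sup>2 / lam u = k"
    using has_field_derivative_zero_constant[of "{c..s}" "\<lambda>u. (I u)\<^sup>2 / lam u"] by auto
  have "k = 0"
    using k[of c] s by (simp add: I_def)
  then have "I s = 0"
    using k[of s] s nz[OF s] by simp
  then show ?thesis
    using eqI[OF s] nz[OF s] by simp
qed

text \<open>
  After the substitution \<open>\<sigma> = s - z + 2 * z * u\<close> the quotient is twice a parametric integral over
  \<open>u \<in> {0..1}\<close> that is continuous down to \<open>z = 0\<close>, where its integrand is the constant \<open>k 0 s\<close>.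
\<close>

lemma tendsto_shrinking_average:
  fixes k :: "real \<Rightarrow> real \<Rightarrow> real"
  assumes "z0 > 0" and k: "continuous_on (SIGMA z:{0..z0}. {s - z..s + z}) (\<lambda>(z, \<sigma>). k z \<sigma>)"
  shows "((\<lambda>z. integral {s - z..s + z} (k z) / z) \<longlongrightarrow> 2 * k 0 s) (at_right 0)"
proof -
  let ?h = "\<lambda>z. integral {0..1} (\<lambda>u. k z (s - z + u * (2 * z)))"
  have seg: "s - z + u * (2 * z) \<in> {s - z..s + z}" if "z \<in> {0..z0}" "u \<in> {0..1}" for z u
    using that mult_left_le_one_le[of "2 * z" u] by auto
  have "continuous_on ({0..z0} \<times> cbox 0 1) (\<lambda>(z, u). k z (s - z + u * (2 * z)))"
  proof -
    have "continuous_on ({0..z0} \<times> cbox 0 1) (\<lambda>p. (fst p, s - fst p + snd p * (2 * fst p)))"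
      by (intro continuous_intros)
    from continuous_on_compose2[OF k this] show ?thesis
      using seg by (fastforce simp: case_prod_beta)
  qed
  then have "continuous_on {0..z0} ?h"
    using integral_continuous_on_param[of "{0..z0}" 0 1 "\<lambda>z u. k z (s - z + u * (2 * z))"] by simp
  then have "(?h \<longlongrightarrow> ?h 0) (at 0 within {0..z0})"
    unfolding continuous_on_def by (rule bspec) (use \<open>z0 > 0\<close> in simp)
  then have "((\<lambda>z. 2 * ?h z) \<longlongrightarrow> 2 * k 0 s) (at_right 0)"
    using \<open>z0 > 0\<close> by (intro tendsto_intros) (simp add: at_within_Icc_at_right)
  moreover have "\<forall>\<^sub>F z in at_right 0. 2 * ?h z = integral {s - z..s + z} (k z) / z"
    unfolding eventually_at_right_field
  proof (intro exI[of _ z0] conjI allI impI \<open>z0 > 0\<close>)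
    fix z :: real assume z: "0 < z" "z < z0"
    have "continuous_on {s - z..s + z} (k z)"
      using continuous_on_compose2[OF k, of "{s - z..s + z}" "\<lambda>\<sigma>. (z, \<sigma>)"] z
      by (simp add: continuous_on_Pair image_subset_iff)
    then show "2 * ?h z = integral {s - z..s + z} (k z) / z"
      using integral_unit_interval[of "s - z" "s + z" "k z"] z by simp
  qed
  ultimately show ?thesis
    by (rule Lim_transform_eventually)
qed

section \<open>The data and the boundary forcing\<close>

lemma C1_on_positive_reals:
  fixes lam :: "real \<Rightarrow> real"
  assumes "lam C1_differentiable_on {0<..}"
  shows "\<And>r. r > 0 \<Longrightarrow> (lam has_real_derivative deriv lam r) (at r)"
    and "continuous_on {0<..} (deriv lam)" and "continuous_on {0<..} lam"
proof -
  obtain D where D: "\<And>r. r > 0 \<Longrightarrow> (lam has_vector_derivative D r) (at r)" "continuous_on {0<..} D"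
    using assms unfolding C1_differentiable_on_def by auto
  then have D': "(lam has_real_derivative D r) (at r)" if "r > 0" for r
    using that by (simp add: has_real_derivative_iff_has_vector_derivative)
  then have d: "deriv lam r = D r" if "r > 0" for r
    using that DERIV_imp_deriv by blast
  show r: "(lam has_real_derivative deriv lam r) (at r)" if "r > 0" for r
    using D'[OF that] d[OF that] by simp
  show "continuous_on {0<..} (deriv lam)"
    using D(2) d by (subst continuous_on_cong[OF refl, of _ _ D]) auto
  show "continuous_on {0<..} lam"
    using r by (intro continuous_at_imp_continuous_on ballI) (auto intro: DERIV_isCont)
qed

text \<open>
  All three boundary curves lie in the frontier, and the corners \<open>(c, 0)\<close> and \<open>(0, c)\<close> belong to two
  of them each.
\<close>

lemma C0_compatible_continuous:
  assumes c: "c > 0" and comp: "C0_compatible c g h f"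
  shows "continuous_on {c..} g" "continuous_on {c..} h" "continuous_on {0..c} f"
    "g c = f c" "h c = f 0"
proof -
  obtain U \<phi> where U: "frontier (Omega c) \<subseteq> U" "continuous_on U \<phi>"
    and g: "\<And>s. s \<ge> c \<Longrightarrow> \<phi> (s, 0) = g s" and h: "\<And>t. t \<ge> c \<Longrightarrow> \<phi> (0, t) = h t"
    and f: "\<And>s. s \<in> {0..c} \<Longrightarrow> \<phi> (s, c - s) = f s"
    using comp unfolding C0_compatible_def by blast
  have "open (Omega c)"
    unfolding Omega_def case_prod_beta by (intro open_Collect_conj open_Collect_less continuous_intros)
  then have fr: "frontier (Omega c) = wedge c - Omega c"
    by (simp add: frontier_def interior_open closure_Omega)
  have "continuous_on {c..} (\<lambda>s. \<phi> (s, 0))"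
    by (intro continuous_on_compose2[OF U(2)] continuous_intros)
      (use U(1) fr c in \<open>auto simp: wedge_def Omega_def\<close>)
  then show "continuous_on {c..} g"
    using g by (subst (asm) continuous_on_cong[OF refl]) auto
  have "continuous_on {c..} (\<lambda>t. \<phi> (0, t))"
    by (intro continuous_on_compose2[OF U(2)] continuous_intros)
      (use U(1) fr c in \<open>auto simp: wedge_def Omega_def\<close>)
  then show "continuous_on {c..} h"
    using h by (subst (asm) continuous_on_cong[OF refl]) auto
  have "continuous_on {0..c} (\<lambda>s. \<phi> (s, c - s))"
    by (intro continuous_on_compose2[OF U(2)] continuous_intros)
      (use U(1) fr c in \<open>auto simp: wedge_def Omega_def\<close>)
  then show "continuous_on {0..c} f"
    using f by (subst (asm) continuous_on_cong[OF refl]) auto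
  show "g c = f c" using g[of c] f[of c] c by simp
  show "h c = f 0" using h[of c] f[of 0] c by simp
qed

context
  fixes c :: real and lam g h f n :: "real \<Rightarrow> real"
  assumes c: "c > 0" and C1: "lam C1_differentiable_on {0<..}"
    and nz: "\<forall>r>0. lam r \<noteq> 0" and wc: "weakly_compatible c g h f n"
begin

lemma data_facts:
  shows data_cont: "continuous_on {c..} g" "continuous_on {c..} h" "continuous_on {0..c} f"
    and corner: "g c = f c" "h c = f 0"
    and f_ac: "abs_cont_on {0..c} f" and n_int: "n integrable_on {0..c}"
  using wc C0_compatible_continuous[OF c] unfolding weakly_compatible_def
  by (auto simp: absolutely_integrable_on_def)

lemma lam_facts:
  shows lam_deriv: "\<And>r. r \<ge> c \<Longrightarrow> (lam has_real_derivative deriv lam r) (at r)"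
    and lam'_cont: "continuous_on {c..} (deriv lam)" and lam_cont: "continuous_on {c..} lam"
    and lam_nz: "\<And>r. r \<ge> c \<Longrightarrow> lam r \<noteq> 0"
  using C1_on_positive_reals[OF C1] c nz
  by (auto intro: continuous_on_subset[of "{0<..}"])

lemma continuous_edge_forcing:
  assumes g: "continuous_on {c..} g'"
  shows "continuous_on {c..} (\<lambda>s. 2 * lam s * g' s - lam c * g' c - integral {c..s} (\<lambda>\<sigma>. g' \<sigma> * deriv lam \<sigma>))"
proof (intro continuous_intros lam_cont g)
  have "continuous_on (SIGMA s:{c..}. {c..s}) (\<lambda>(s, \<sigma>). g' \<sigma> * deriv lam \<sigma>)"
    unfolding case_prod_beta
    by (intro continuous_intros continuous_on_compose2[OF g] continuous_on_compose2[OF lam'_cont]) auto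
  then show "continuous_on {c..} (\<lambda>s. integral {c..s} (\<lambda>\<sigma>. g' \<sigma> * deriv lam \<sigma>))"
    by (intro continuous_on_integral_variable_limits continuous_intros) auto
qed

text \<open>
  The two branches agree at \<open>s = c\<close>, where the second equals \<open>lam c * g c\<close>, because \<open>g c = f c\<close>.
\<close>

lemma continuous_G1: "continuous_on {0..} (G1 c lam g f)"
  unfolding G1_def
proof (intro continuous_on_cases_1)
  show "continuous_on {t \<in> {0..}. t \<le> c} (\<lambda>s. lam c * f s)"
    by (intro continuous_intros continuous_on_subset[OF data_cont(3)]) auto
  show "continuous_on {t \<in> {0..}. c \<le> t}
      (\<lambda>s. 2 * lam s * g s - lam c * g c - integral {c..s} (\<lambda>\<sigma>. g \<sigma> * deriv lam \<sigma>))"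
    by (rule continuous_on_subset[OF continuous_edge_forcing[OF data_cont(1)]]) auto
qed (simp add: corner)

lemma continuous_G2: "continuous_on {0..} (G2 c lam h f)"
  unfolding G2_def
proof (intro continuous_on_cases_1)
  show "continuous_on {t \<in> {0..}. t \<le> c} (\<lambda>t. lam c * f (c - t))"
    by (intro continuous_intros continuous_on_compose2[OF data_cont(3)]) auto
  show "continuous_on {t \<in> {0..}. c \<le> t}
      (\<lambda>t. 2 * lam t * h t - lam c * h c - integral {c..t} (\<lambda>\<tau>. h \<tau> * deriv lam \<tau>))"
    by (rule continuous_on_subset[OF continuous_edge_forcing[OF data_cont(2)]]) auto
qed (simp add: corner)

text \<open>
  The integral of \<open>n\<close> is a difference of two values of a continuous indefinite integral.
\<close>

lemma continuous_forcing: "continuous_on (wedge c) (\<lambda>(s, t). forcing c lam g h f n s t)"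
proof -
  let ?N = "\<lambda>u. integral {0..u} n"
  have N: "continuous_on {0..c} ?N"
    using n_int by (rule indefinite_integral_continuous_1)
  have split: "integral {max (c - t) 0..min c s} (\<lambda>\<sigma>. lam c * n \<sigma>)
      = lam c * (?N (min c s) - ?N (max (c - t) 0))" if "(s, t) \<in> wedge c" for s t
  proof -
    have le: "0 \<le> max (c - t) 0" "max (c - t) 0 \<le> min c s"
      using that c by (auto simp: wedge_def)
    have "n integrable_on {0..min c s}"
      using n_int by (rule integrable_on_subinterval) auto
    from Henstock_Kurzweil_Integration.integral_combine[OF le this] show ?thesis
      by simp
  qed
  have "continuous_on (wedge c) (\<lambda>p. lam c * (?N (min c (fst p)) - ?N (max (c - snd p) 0)))"
    using c by (intro continuous_intros continuous_on_compose2[OF N]) (auto simp: wedge_def)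
  then have *: "continuous_on (wedge c)
      (\<lambda>p. integral {max (c - snd p) 0..min c (fst p)} (\<lambda>\<sigma>. lam c * n \<sigma>))"
    by (rule continuous_on_eq) (rule split[symmetric], simp)
  show ?thesis
    unfolding forcing_def boundary_forcing_def case_prod_beta
    using lam_nz
    by (intro continuous_intros * continuous_on_compose2[OF continuous_G1]
        continuous_on_compose2[OF continuous_G2] continuous_on_compose2[OF lam_cont])
      (auto simp: wedge_def)
qed

lemma solves_volterra_iff:
  "solves_volterra c lam g h f n x \<longleftrightarrow>
     (\<forall>p\<in>wedge c. x p = volterra_rhs c (\<lambda>(s, t). forcing c lam g h f n s t)
        (\<lambda>r. 1 / (2 * lam r)) (deriv lam) x p)"
proof -
  have 1: "integral S (\<lambda>\<sigma>. K1 lam s t \<sigma> * x (\<sigma>, t)) =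
      1 / (2 * lam (s + t)) * integral S (\<lambda>\<sigma>. deriv lam (\<sigma> + t) * x (\<sigma>, t))" for S s t
    by (subst integral_mult_right[symmetric]) (simp add: K1_def)
  have 2: "integral S (\<lambda>\<tau>. K2 lam s t \<tau> * x (s, \<tau>)) =
      1 / (2 * lam (s + t)) * integral S (\<lambda>\<tau>. deriv lam (s + \<tau>) * x (s, \<tau>))" for S s t
    by (subst integral_mult_right[symmetric]) (simp add: K2_def)
  show ?thesis
    unfolding solves_volterra_def closure_Omega 1 2 volterra_rhs_def
    by (simp add: case_prod_beta distrib_left add.assoc split: prod.splits)
qed

section \<open>Attainment of the boundary conditions\<close>

context
  fixes x :: "real \<times> real \<Rightarrow> real"
  assumes x_cont: "continuous_on (wedge c) x" and sol: "solves_volterra c lam g h f n x"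
begin

lemma multiplied_equation:
  assumes "(s, t) \<in> wedge c"
  shows "2 * lam (s + t) * x (s, t) = boundary_forcing c lam g h f n s t
    + integral {max (c - t) 0..s} (\<lambda>\<sigma>. deriv lam (\<sigma> + t) * x (\<sigma>, t))
    + integral {max (c - s) 0..t} (\<lambda>\<tau>. deriv lam (s + \<tau>) * x (s, \<tau>))"
proof -
  have "x (s, t) = volterra_rhs c (\<lambda>(s, t). forcing c lam g h f n s t)
        (\<lambda>r. 1 / (2 * lam r)) (deriv lam) x (s, t)"
    using sol assms unfolding solves_volterra_iff by blast
  moreover have "lam (s + t) \<noteq> 0"
    using assms by (intro lam_nz) (simp add: wedge_def)
  ultimately show ?thesis
    by (simp add: volterra_rhs_def forcing_def field_simps)
qed

text \<open>
  On the diagonal all intervals of integration are degenerate.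
\<close>

lemma value_on_diagonal:
  assumes "s \<in> {0..c}"
  shows "x (s, c - s) = f s"
proof -
  have "(s, c - s) \<in> wedge c" "max (c - (c - s)) 0 = s" "max (c - s) 0 = c - s" "min c s = s"
    using assms by (auto simp: wedge_def)
  then have "2 * lam c * x (s, c - s) = boundary_forcing c lam g h f n s (c - s)"
    using multiplied_equation[of s "c - s"] by simp
  also have "\<dots> = 2 * lam c * f s"
    using assms \<open>min c s = s\<close> by (simp add: boundary_forcing_def G1_def G2_def)
  finally show ?thesis
    using lam_nz[of c] by simp
qed

text \<open>
  Subtracting the forcing from the equation on the edge leaves the homogeneous equation for
  \<open>x (s, 0) - g s\<close>; the corner \<open>s = c\<close> is covered by the diagonal.
\<close>

lemma value_on_horizontal_edge:
  assumes "s \<ge> c"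
  shows "x (s, 0) = g s"
proof -
  let ?w = "\<lambda>s. x (s, 0) - g s"
  have xe: "continuous_on {c..} (\<lambda>s. x (s, 0))"
    using c by (intro continuous_on_compose2[OF x_cont] continuous_intros) (auto simp: wedge_def)
  have "2 * lam s * ?w s = integral {c..s} (\<lambda>\<sigma>. deriv lam \<sigma> * ?w \<sigma>)" if "s \<ge> c" for s
  proof (cases "s = c")
    case True
    then show ?thesis
      using value_on_diagonal[of c] c corner by simp
  next
    case False
    then have "s > c" using that by simp
    have int: "(\<lambda>\<sigma>. deriv lam \<sigma> * x (\<sigma>, 0)) integrable_on {c..s}" "(\<lambda>\<sigma>. deriv lam \<sigma> * g \<sigma>) integrable_on {c..s}"
      by (intro integrable_continuous_real continuous_intros continuous_on_subset[OF xe]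
          continuous_on_subset[OF data_cont(1)] continuous_on_subset[OF lam'_cont]; auto)+
    have "2 * lam s * x (s, 0) = boundary_forcing c lam g h f n s 0 + integral {c..s} (\<lambda>\<sigma>. deriv lam \<sigma> * x (\<sigma>, 0))"
      using multiplied_equation[of s 0] \<open>s > c\<close> c by (simp add: wedge_def max_def)
    also have "boundary_forcing c lam g h f n s 0 = 2 * lam s * g s - integral {c..s} (\<lambda>\<sigma>. g \<sigma> * deriv lam \<sigma>)"
      using \<open>s > c\<close> c corner by (simp add: boundary_forcing_def G1_def G2_def max_def)
    finally show ?thesis
      using integral_diff[OF int] by (simp add: right_diff_distrib mult.commute)
  qed
  from zero_of_homogeneous_edge_equation[OF lam_deriv lam_nz lam'_cont _ this assms]
  show ?thesis
    using xe data_cont(1) by (simp add: continuous_on_diff)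
qed

lemma value_on_vertical_edge:
  assumes "t \<ge> c"
  shows "x (0, t) = h t"
proof -
  let ?w = "\<lambda>t. x (0, t) - h t"
  have xe: "continuous_on {c..} (\<lambda>t. x (0, t))"
    using c by (intro continuous_on_compose2[OF x_cont] continuous_intros) (auto simp: wedge_def)
  have "2 * lam t * ?w t = integral {c..t} (\<lambda>\<tau>. deriv lam \<tau> * ?w \<tau>)" if "t \<ge> c" for t
  proof (cases "t = c")
    case True
    then show ?thesis
      using value_on_diagonal[of 0] c corner by simp
  next
    case False
    then have "t > c" using that by simp
    have int: "(\<lambda>\<tau>. deriv lam \<tau> * x (0, \<tau>)) integrable_on {c..t}" "(\<lambda>\<tau>. deriv lam \<tau> * h \<tau>) integrable_on {c..t}"
      by (intro integrable_continuous_real continuous_intros continuous_on_subset[OF xe]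
          continuous_on_subset[OF data_cont(2)] continuous_on_subset[OF lam'_cont]; auto)+
    have "2 * lam t * x (0, t) = boundary_forcing c lam g h f n 0 t + integral {c..t} (\<lambda>\<tau>. deriv lam \<tau> * x (0, \<tau>))"
      using multiplied_equation[of 0 t] \<open>t > c\<close> c by (simp add: wedge_def max_def)
    also have "boundary_forcing c lam g h f n 0 t = 2 * lam t * h t - integral {c..t} (\<lambda>\<tau>. h \<tau> * deriv lam \<tau>)"
      using \<open>t > c\<close> c corner by (simp add: boundary_forcing_def G1_def G2_def max_def)
    finally show ?thesis
      using integral_diff[OF int] by (simp add: right_diff_distrib mult.commute)
  qed
  from zero_of_homogeneous_edge_equation[OF lam_deriv lam_nz lam'_cont _ this assms]
  show ?thesis
    using xe data_cont(2) by (simp add: continuous_on_diff)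
qed

text \<open>
  The difference quotient is expanded with the equation at \<open>(s + z, c - s + z)\<close>. In the limit the two
  \<open>lam'\<close> integrals contribute \<open>4 * lam' c * f s\<close> in total, which is exactly what the difference
  quotient of \<open>2 * lam (c + 2 * z) * f s\<close> removes, and \<open>2 * lam c * n s\<close> remains over \<open>2 * lam c\<close>.
\<close>

lemma normal_derivative:
  assumes s: "0 < s" "s < c"
    and f2: "((\<lambda>z. (f (s + z) + f (s - z) - 2 * f s) / z) \<longlongrightarrow> 0) (at_right 0)"
    and n2: "((\<lambda>z. integral {s - z..s + z} n / z) \<longlongrightarrow> 2 * n s) (at_right 0)"
  shows "((\<lambda>z. (x (s + z, c - s + z) - x (s, c - s)) / z) \<longlongrightarrow> n s) (at_right 0)"
proof -
  \<comment> \<open>up to \<open>z0\<close> all arguments of \<open>f\<close> and \<open>n\<close> stay in \<open>{0..c}\<close>\<close>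
  define z0 where "z0 = min s (c - s)"
  have "z0 > 0" using s by (simp add: z0_def)
  define J1 where "J1 z = integral {s - z..s + z} (\<lambda>\<sigma>. deriv lam (\<sigma> + (c - s + z)) * x (\<sigma>, c - s + z))" for z
  define J2 where "J2 z = integral {c - s - z..c - s + z} (\<lambda>\<tau>. deriv lam (s + z + \<tau>) * x (s + z, \<tau>))" for z
  have xs: "x (s, c - s) = f s"
    using value_on_diagonal[of s] s by simp
  have "continuous_on (SIGMA z:{0..z0}. {s - z..s + z})
      (\<lambda>(z, \<sigma>). deriv lam (\<sigma> + (c - s + z)) * x (\<sigma>, c - s + z))"
    unfolding case_prod_beta
    by (intro continuous_intros continuous_on_compose2[OF lam'_cont] continuous_on_compose2[OF x_cont])
      (use s in \<open>auto simp: wedge_def z0_def\<close>)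
  from tendsto_shrinking_average[OF \<open>z0 > 0\<close> this]
  have J1: "((\<lambda>z. J1 z / z) \<longlongrightarrow> 2 * (deriv lam c * f s)) (at_right 0)"
    using xs by (simp add: J1_def)
  have "continuous_on (SIGMA z:{0..z0}. {(c - s) - z..(c - s) + z})
      (\<lambda>(z, \<tau>). deriv lam (s + z + \<tau>) * x (s + z, \<tau>))"
    unfolding case_prod_beta
    by (intro continuous_intros continuous_on_compose2[OF lam'_cont] continuous_on_compose2[OF x_cont])
      (use s in \<open>auto simp: wedge_def z0_def\<close>)
  from tendsto_shrinking_average[OF \<open>z0 > 0\<close> this]
  have J2: "((\<lambda>z. J2 z / z) \<longlongrightarrow> 2 * (deriv lam c * f s)) (at_right 0)"
    using xs by (simp add: J2_def)
  have D: "((\<lambda>z. lam (c + 2 * z)) has_real_derivative deriv lam c * 2) (at 0)"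
    using lam_deriv[of c] by (intro DERIV_chain'[of _ _ _ _ lam]) (auto intro!: derivative_eq_intros)
  then have L: "((\<lambda>z. (lam (c + 2 * z) - lam c) / z) \<longlongrightarrow> deriv lam c * 2) (at_right 0)"
    unfolding DERIV_def by (auto intro: tendsto_mono[OF at_le])
  have "isCont (\<lambda>z. lam (c + 2 * z)) 0"
    using D by (rule DERIV_isCont)
  then have Lc: "((\<lambda>z. lam (c + 2 * z)) \<longlongrightarrow> lam c) (at_right 0)"
    unfolding isCont_def by (auto intro: tendsto_mono[OF at_le])
  let ?Q = "\<lambda>z. (lam c * ((f (s + z) + f (s - z) - 2 * f s) / z) + lam c * (integral {s - z..s + z} n / z)
      + J1 z / z + J2 z / z - 2 * f s * ((lam (c + 2 * z) - lam c) / z)) / (2 * lam (c + 2 * z))"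
  have "(?Q \<longlongrightarrow> (lam c * 0 + lam c * (2 * n s) + 2 * (deriv lam c * f s) + 2 * (deriv lam c * f s)
      - 2 * f s * (deriv lam c * 2)) / (2 * lam c)) (at_right 0)"
    using lam_nz[of c] by (intro tendsto_intros f2 n2 J1 J2 L Lc) auto
  moreover have "(lam c * 0 + lam c * (2 * n s) + 2 * (deriv lam c * f s) + 2 * (deriv lam c * f s)
      - 2 * f s * (deriv lam c * 2)) / (2 * lam c) = n s"
    using lam_nz[of c] by (simp add: field_simps)
  ultimately have "(?Q \<longlongrightarrow> n s) (at_right 0)"
    by simp
  moreover have "\<forall>\<^sub>F z in at_right 0. ?Q z = (x (s + z, c - s + z) - x (s, c - s)) / z"
    unfolding eventually_at_right_field
  proof (intro exI[of _ z0] conjI allI impI \<open>z0 > 0\<close>)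
    fix z assume z: "0 < z" "z < z0"
    have "(s + z, c - s + z) \<in> wedge c" and sum: "s + z + (c - s + z) = c + 2 * z"
      and lims: "max (c - (c - s + z)) 0 = s - z" "max (c - (s + z)) 0 = c - s - z" "min c (s + z) = s + z"
      using z s by (auto simp: wedge_def z0_def)
    from multiplied_equation[OF this(1)]
    have "2 * lam (c + 2 * z) * x (s + z, c - s + z) =
        boundary_forcing c lam g h f n (s + z) (c - s + z) + J1 z + J2 z"
      unfolding sum lims J1_def J2_def .
    also have "boundary_forcing c lam g h f n (s + z) (c - s + z) =
        lam c * f (s + z) + lam c * f (s - z) + lam c * integral {s - z..s + z} n"
      using z s unfolding boundary_forcing_def G1_def G2_def lims by (simp add: z0_def)
    finally have eq: "2 * lam (c + 2 * z) * x (s + z, c - s + z) =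
        lam c * f (s + z) + lam c * f (s - z) + lam c * integral {s - z..s + z} n + J1 z + J2 z" .
    have "?Q z = (2 * lam (c + 2 * z) * x (s + z, c - s + z) - 2 * lam (c + 2 * z) * f s) / z
        / (2 * lam (c + 2 * z))"
      unfolding eq by (rule arg_cong[where f="\<lambda>q. q / (2 * lam (c + 2 * z))"])
        (simp add: divide_inverse algebra_simps)
    also have "\<dots> = (x (s + z, c - s + z) - f s) / z"
      using lam_nz[of "c + 2 * z"] z(1) by (simp add: field_simps)
    finally show "?Q z = (x (s + z, c - s + z) - x (s, c - s)) / z"
      using xs by simp
  qed
  ultimately show ?thesis
    by (rule Lim_transform_eventually)
qed

lemma attains_data: "attains c g h f n x"
  unfolding attains_def
proof (intro conjI allI impI ballI)
  obtain N1 where N1: "negligible N1" "\<And>s. s \<in> {0<..<c} - N1 \<Longrightarrow>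
       ((\<lambda>z. (f (s + z) + f (s - z) - 2 * f s) / z) \<longlongrightarrow> 0) (at_right 0)"
    using abs_cont_on_second_difference[OF f_ac] c by auto
  obtain N2 where N2: "negligible N2" "\<And>s. s \<in> {0<..<c} - N2 \<Longrightarrow>
       ((\<lambda>z. integral {s - z..s + z} n / z) \<longlongrightarrow> 2 * n s) (at_right 0)"
    using lebesgue_differentiation_symmetric[OF n_int] by blast
  have "negligible (N1 \<union> N2 \<union> {0, c})"
    using N1(1) N2(1) by (intro negligible_Un) auto
  then have "N1 \<union> N2 \<union> {0, c} \<in> null_sets lebesgue"
    by (simp add: negligible_iff_null_sets)
  then have "AE s in lebesgue. s \<in> {0..c} \<longrightarrow>
      ((\<lambda>z. (x (s + z, c - s + z) - x (s, c - s)) / z) \<longlongrightarrow> n s) (at_right 0)"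
  proof (rule AE_I')
    show "{s \<in> space lebesgue. \<not> (s \<in> {0..c} \<longrightarrow>
        ((\<lambda>z. (x (s + z, c - s + z) - x (s, c - s)) / z) \<longlongrightarrow> n s) (at_right 0))} \<subseteq> N1 \<union> N2 \<union> {0, c}"
    proof (rule subsetI, rule ccontr)
      fix s assume "s \<in> {s \<in> space lebesgue. \<not> (s \<in> {0..c} \<longrightarrow>
          ((\<lambda>z. (x (s + z, c - s + z) - x (s, c - s)) / z) \<longlongrightarrow> n s) (at_right 0))}"
        and "s \<notin> N1 \<union> N2 \<union> {0, c}"
      then show False
        using normal_derivative[of s] N1(2)[of s] N2(2)[of s] by auto
    qed
  qed
  then show "AE s in lebesgue_on {0..c}.
      ((\<lambda>z. (x (s + z, c - s + z) - x (s, c - s)) / z) \<longlongrightarrow> n s) (at_right 0)"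
    by (subst AE_restrict_space_iff) auto
qed (use value_on_horizontal_edge value_on_vertical_edge value_on_diagonal in auto)

end

end

theorem proposition5p11:
  fixes c :: real and lam g h f n :: "real \<Rightarrow> real"
  assumes "c > 0"
    and "lam C1_differentiable_on {0<..}"
    and "\<forall>r>0. lam r \<noteq> 0"
    and "weakly_compatible c g h f n"
  shows "\<exists>x. continuous_on (closure (Omega c)) x \<and> solves_volterra c lam g h f n x \<and>
           (\<forall>y. continuous_on (closure (Omega c)) y \<and> solves_volterra c lam g h f n y \<longrightarrow>
              (\<forall>p \<in> closure (Omega c). y p = x p)) \<and>
           attains c g h f n x"
proof -
  have A: "continuous_on {c..} (\<lambda>r. 1 / (2 * lam r))"
    using lam_facts(4)[OF assms] by (intro continuous_intros lam_facts(3)[OF assms]) auto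
  obtain x where x: "continuous_on (wedge c) x" "solves_volterra c lam g h f n x"
    and uniq: "\<And>y. continuous_on (wedge c) y \<Longrightarrow> solves_volterra c lam g h f n y \<Longrightarrow> \<forall>p\<in>wedge c. y p = x p"
    using volterra_global[OF assms(1) continuous_forcing[OF assms] A lam_facts(2)[OF assms]]
    unfolding solves_volterra_iff[OF assms] by blast
  show ?thesis
    unfolding closure_Omega
    using x uniq attains_data[OF assms x] by blast
qed

end
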